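(* Quaternionic Kähler manifolds with Hermitian-Norden metrics are Einstein for dimension $4n\ge 8$.
   Context: An almost hypercomplex manifold $(M,H)$ is a $4n$-dimensional manifold with a triad $H=(J_1,J_2,J_3)$ of almost complex structures such that $J_\alpha=J_\beta\circ J_\gamma=-J_\gamma\circ J_\beta$, $J_\alpha^2=-I$ for all cyclic permutations $(\alpha,\beta,\gamma)$ of $(1,2,3)$. Hermitian-Norden metrics on it are given by a pseudo-Riemannian metric $g$ of neutral signature with $g(J_\alpha x,J_\alpha y)=\varepsilon_\alpha g(x,y)$, where $\varepsilon_1=1$, $\varepsilon_2=\varepsilon_3=-1$, together with $\tilde g_\alpha(x,y)=g(J_\alpha x,y)$. Let $D$ be the Levi-Civita connection of $g$. The manifold is a quaternionic Kähler manifold with Hermitian-Norden metrics if there are local 1-forms $\omega_1,\omega_2,\omega_3$ such that $$(D_xJ_\alpha)y=\omega_\gamma(x)J_\beta y-\omega_\beta(x)J_\gamma y$$ for all cyclic permutations $(\alpha,\beta,\gamma)$ of $(1,2,3)$. Einstein means that the Ricci tensor of $D$ is proportional to $g$. *)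

theory Defs
  imports "HOL-Analysis.Analysis"
begin

text \<open>Smoothness is meant for open sets \<open>S\<close>: all iterated directional derivatives exist and are
  continuous.\<close>

primrec Ck_on ::
  "nat \<Rightarrow> 'v::real_normed_vector set \<Rightarrow> ('v \<Rightarrow> 'w::real_normed_vector) \<Rightarrow> bool" where
  "Ck_on 0 S f \<longleftrightarrow> continuous_on S f"
| "Ck_on (Suc k) S f \<longleftrightarrow>
     f differentiable_on S \<and> (\<forall>v. Ck_on k S (\<lambda>x. frechet_derivative f (at x) v))"

definition smooth_on ::
  "'v::real_normed_vector set \<Rightarrow> ('v \<Rightarrow> 'w::real_normed_vector) \<Rightarrow> bool" where
  "smooth_on S f \<longleftrightarrow> (\<forall>k. Ck_on k S f)"

text \<open>A chart is a domain together with a coordinate map; the values of the map outside the domain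
  are irrelevant.\<close>

type_synonym ('a, 'm) chart = "'a set \<times> ('a \<Rightarrow> (real, 'm) vec)"

definition param :: "('a, 'm::finite) chart \<Rightarrow> real ^ 'm \<Rightarrow> 'a" where
  "param c = inv_into (fst c) (snd c)"

definition coord_dom :: "('a, 'm::finite) chart \<Rightarrow> (real ^ 'm) set" where
  "coord_dom c = snd c ` fst c"

definition is_chart :: "'a topology \<Rightarrow> ('a, 'm::finite) chart \<Rightarrow> bool" where
  "is_chart X c \<longleftrightarrow> openin X (fst c) \<and> open (coord_dom c) \<and>
     homeomorphic_map (subtopology X (fst c)) (top_of_set (coord_dom c)) (snd c)"

definition transition ::
  "('a, 'm::finite) chart \<Rightarrow> ('a, 'm) chart \<Rightarrow> real ^ 'm \<Rightarrow> real ^ 'm" where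
  "transition c c' = snd c' \<circ> param c"

text \<open>The differential of the change of coordinates, which identifies the coordinates in \<open>c\<close> and
  in \<open>c'\<close> of a tangent vector.\<close>

definition jac ::
  "('a, 'm::finite) chart \<Rightarrow> ('a, 'm) chart \<Rightarrow> real ^ 'm \<Rightarrow> real ^ 'm \<Rightarrow> real ^ 'm" where
  "jac c c' x = frechet_derivative (transition c c') (at x)"

definition hess ::
  "('a, 'm::finite) chart \<Rightarrow> ('a, 'm) chart \<Rightarrow> real ^ 'm \<Rightarrow> real ^ 'm \<Rightarrow> real ^ 'm \<Rightarrow> real ^ 'm" where
  "hess c c' x u v = frechet_derivative (\<lambda>z. jac c c' z v) (at x) u"

definition smooth_manifold :: "'a topology \<Rightarrow> ('a, 'm::finite) chart set \<Rightarrow> bool" where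
  "smooth_manifold X A \<longleftrightarrow>
     Hausdorff_space X \<and> second_countable X \<and>
     (\<forall>c\<in>A. is_chart X c) \<and> (\<Union>c\<in>A. fst c) = topspace X \<and>
     (\<forall>c\<in>A. \<forall>c'\<in>A. smooth_on (snd c ` (fst c \<inter> fst c')) (transition c c'))"

text \<open>
  Tensor fields and connections are given by their components in the charts of the atlas together
  with the transformation law under changes of coordinates: the component of a field in the chart
  \<open>c\<close> is a function of the coordinate point \<open>x \<in> coord_dom c\<close> and of coordinate vectors at \<open>x\<close>.
\<close>

type_synonym ('a, 'm) one_form =
  "('a, 'm) chart \<Rightarrow> (real, 'm) vec \<Rightarrow> (real, 'm) vec \<Rightarrow> real"
type_synonym ('a, 'm) bilinear_field =
  "('a, 'm) chart \<Rightarrow> (real, 'm) vec \<Rightarrow> (real, 'm) vec \<Rightarrow> (real, 'm) vec \<Rightarrow> real"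
type_synonym ('a, 'm) endo_field =
  "('a, 'm) chart \<Rightarrow> (real, 'm) vec \<Rightarrow> (real, 'm) vec \<Rightarrow> (real, 'm) vec"
type_synonym ('a, 'm) connection =
  "('a, 'm) chart \<Rightarrow> (real, 'm) vec \<Rightarrow> (real, 'm) vec \<Rightarrow> (real, 'm) vec \<Rightarrow> (real, 'm) vec"

definition one_form_on ::
  "('a, 'm::finite) chart set \<Rightarrow> 'a set \<Rightarrow> ('a, 'm) one_form \<Rightarrow> bool" where
  "one_form_on A W \<omega> \<longleftrightarrow>
     (\<forall>c\<in>A. (\<forall>x \<in> snd c ` (fst c \<inter> W). linear (\<omega> c x)) \<and>
            (\<forall>u. smooth_on (snd c ` (fst c \<inter> W)) (\<lambda>x. \<omega> c x u))) \<and>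
     (\<forall>c\<in>A. \<forall>c'\<in>A. \<forall>p \<in> fst c \<inter> fst c' \<inter> W. \<forall>u.
        \<omega> c' (snd c' p) (jac c c' (snd c p) u) = \<omega> c (snd c p) u)"

definition is_endo_field ::
  "('a, 'm::finite) chart set \<Rightarrow> ('a, 'm) endo_field \<Rightarrow> bool" where
  "is_endo_field A J \<longleftrightarrow>
     (\<forall>c\<in>A. (\<forall>x \<in> coord_dom c. linear (J c x)) \<and>
            (\<forall>u. smooth_on (coord_dom c) (\<lambda>x. J c x u))) \<and>
     (\<forall>c\<in>A. \<forall>c'\<in>A. \<forall>p \<in> fst c \<inter> fst c'. \<forall>u.
        J c' (snd c' p) (jac c c' (snd c p) u) = jac c c' (snd c p) (J c (snd c p) u))"

definition is_bilinear_field ::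
  "('a, 'm::finite) chart set \<Rightarrow> ('a, 'm) bilinear_field \<Rightarrow> bool" where
  "is_bilinear_field A g \<longleftrightarrow>
     (\<forall>c\<in>A. (\<forall>x \<in> coord_dom c. bilinear (g c x)) \<and>
            (\<forall>u v. smooth_on (coord_dom c) (\<lambda>x. g c x u v))) \<and>
     (\<forall>c\<in>A. \<forall>c'\<in>A. \<forall>p \<in> fst c \<inter> fst c'. \<forall>u v.
        g c' (snd c' p) (jac c c' (snd c p) u) (jac c c' (snd c p) v) = g c (snd c p) u v)"

text \<open>A bilinear form has signature \<open>(p, q)\<close> if it has an orthonormal basis with \<open>p\<close> vectors of
  square \<open>1\<close> and \<open>q\<close> vectors of square \<open>-1\<close>.\<close>

definition has_signature ::
  "(real ^ 'm \<Rightarrow> real ^ 'm \<Rightarrow> real) \<Rightarrow> nat \<Rightarrow> nat \<Rightarrow> bool" where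
  "has_signature B p q \<longleftrightarrow>
     (\<exists>(e :: 'm \<Rightarrow> real ^ 'm) P.
        inj e \<and> independent (range e) \<and> span (range e) = UNIV \<and>
        card P = p \<and> card (- P) = q \<and>
        (\<forall>i j. B (e i) (e j) = (if i = j then (if i \<in> P then 1 else -1) else 0)))"

definition neutral_metric ::
  "('a, 'm::finite) chart set \<Rightarrow> ('a, 'm) bilinear_field \<Rightarrow> bool" where
  "neutral_metric A g \<longleftrightarrow> is_bilinear_field A g \<and>
     (\<forall>c\<in>A. \<forall>x \<in> coord_dom c.
        (\<forall>u v. g c x u v = g c x v u) \<and> (\<exists>k. has_signature (g c x) k k))"

text \<open>The transformation law below is that of Christoffel symbols, i.e. it says that the covariant
  derivatives \<open>nabla (D c)\<close> (defined next) in the different charts agree.\<close>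

definition affine_connection ::
  "('a, 'm::finite) chart set \<Rightarrow> ('a, 'm) connection \<Rightarrow> bool" where
  "affine_connection A D \<longleftrightarrow>
     (\<forall>c\<in>A. (\<forall>x \<in> coord_dom c. bilinear (D c x)) \<and>
            (\<forall>u v. smooth_on (coord_dom c) (\<lambda>x. D c x u v))) \<and>
     (\<forall>c\<in>A. \<forall>c'\<in>A. \<forall>p \<in> fst c \<inter> fst c'. \<forall>u v.
        D c' (snd c' p) (jac c c' (snd c p) u) (jac c c' (snd c p) v) =
          jac c c' (snd c p) (D c (snd c p) u v) - hess c c' (snd c p) u v)"

definition nabla ::
  "(real ^ 'm \<Rightarrow> real ^ 'm \<Rightarrow> real ^ 'm \<Rightarrow> real ^ 'm) \<Rightarrow>
   (real ^ 'm \<Rightarrow> real ^ 'm) \<Rightarrow> (real ^ 'm \<Rightarrow> real ^ 'm) \<Rightarrow> real ^ 'm \<Rightarrow> real ^ 'm" where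
  "nabla \<Gamma> Y Z = (\<lambda>x. frechet_derivative Z (at x) (Y x) + \<Gamma> x (Y x) (Z x))"

definition lie_bracket ::
  "(real ^ 'm \<Rightarrow> real ^ 'm) \<Rightarrow> (real ^ 'm \<Rightarrow> real ^ 'm) \<Rightarrow> real ^ 'm \<Rightarrow> real ^ 'm" where
  "lie_bracket Y Z =
     (\<lambda>x. frechet_derivative Z (at x) (Y x) - frechet_derivative Y (at x) (Z x))"

definition levi_civita ::
  "('a, 'm::finite) chart set \<Rightarrow> ('a, 'm) bilinear_field \<Rightarrow> ('a, 'm) connection \<Rightarrow> bool" where
  "levi_civita A g D \<longleftrightarrow> affine_connection A D \<and>
     (\<forall>c\<in>A. \<forall>Y Z. smooth_on (coord_dom c) Y \<longrightarrow> smooth_on (coord_dom c) Z \<longrightarrow>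
        (\<forall>x \<in> coord_dom c.
           nabla (D c) Y Z x - nabla (D c) Z Y x = lie_bracket Y Z x)) \<and>
     (\<forall>c\<in>A. \<forall>Y Z V. smooth_on (coord_dom c) Y \<longrightarrow> smooth_on (coord_dom c) Z \<longrightarrow>
        smooth_on (coord_dom c) V \<longrightarrow>
        (\<forall>x \<in> coord_dom c.
           frechet_derivative (\<lambda>z. g c z (Z z) (V z)) (at x) (Y x) =
             g c x (nabla (D c) Y Z x) (V x) + g c x (Z x) (nabla (D c) Y V x)))"

text \<open>The covariant derivative \<open>(\<nabla>\<^bsub>Y\<^esub> J) Z\<close> of a (1,1)-tensor field.\<close>

definition nabla_endo ::
  "(real ^ 'm \<Rightarrow> real ^ 'm \<Rightarrow> real ^ 'm \<Rightarrow> real ^ 'm) \<Rightarrow> (real ^ 'm \<Rightarrow> real ^ 'm \<Rightarrow> real ^ 'm) \<Rightarrow>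
   (real ^ 'm \<Rightarrow> real ^ 'm) \<Rightarrow> (real ^ 'm \<Rightarrow> real ^ 'm) \<Rightarrow> real ^ 'm \<Rightarrow> real ^ 'm" where
  "nabla_endo \<Gamma> J Y Z = (\<lambda>x. nabla \<Gamma> Y (\<lambda>z. J z (Z z)) x - J x (nabla \<Gamma> Y Z x))"

definition curvature ::
  "(real ^ 'm \<Rightarrow> real ^ 'm \<Rightarrow> real ^ 'm \<Rightarrow> real ^ 'm) \<Rightarrow>
   (real ^ 'm \<Rightarrow> real ^ 'm) \<Rightarrow> (real ^ 'm \<Rightarrow> real ^ 'm) \<Rightarrow> (real ^ 'm \<Rightarrow> real ^ 'm) \<Rightarrow>
   real ^ 'm \<Rightarrow> real ^ 'm" where
  "curvature \<Gamma> Y Z V =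
     (\<lambda>x. nabla \<Gamma> Y (nabla \<Gamma> Z V) x - nabla \<Gamma> Z (nabla \<Gamma> Y V) x - nabla \<Gamma> (lie_bracket Y Z) V x)"

text \<open>\<open>Ric(v, w) = tr (u \<mapsto> R(u, v) w)\<close>; the curvature being tensorial, its value at \<open>x\<close> may be
  computed with the constant extensions of the coordinate vectors.\<close>

definition ricci ::
  "(real ^ 'm::finite \<Rightarrow> real ^ 'm \<Rightarrow> real ^ 'm \<Rightarrow> real ^ 'm) \<Rightarrow>
   real ^ 'm \<Rightarrow> real ^ 'm \<Rightarrow> real ^ 'm \<Rightarrow> real" where
  "ricci \<Gamma> x v w = trace (matrix (\<lambda>u. curvature \<Gamma> (\<lambda>_. u) (\<lambda>_. v) (\<lambda>_. w) x))"

text \<open>The Einstein factor is constant on every connected set of points, hence a single constant if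
  the manifold is connected (which is not assumed).\<close>

definition einstein ::
  "'a topology \<Rightarrow> ('a, 'm::finite) chart set \<Rightarrow> ('a, 'm) bilinear_field \<Rightarrow>
   ('a, 'm) connection \<Rightarrow> bool" where
  "einstein X A g D \<longleftrightarrow>
     (\<exists>k :: 'a \<Rightarrow> real. (\<forall>C. connectedin X C \<longrightarrow> k constant_on C) \<and>
        (\<forall>c\<in>A. \<forall>p \<in> fst c. \<forall>u v. ricci (D c) (snd c p) u v = k p * g c (snd c p) u v))"

definition cyclic_triples :: "(nat \<times> nat \<times> nat) set" where
  "cyclic_triples = {(1, 2, 3), (2, 3, 1), (3, 1, 2)}"

definition almost_hypercomplex ::
  "('a, 'm::finite) chart set \<Rightarrow> (nat \<Rightarrow> ('a, 'm) endo_field) \<Rightarrow> bool" where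
  "almost_hypercomplex A J \<longleftrightarrow>
     (\<forall>\<alpha> \<in> {1, 2, 3}. is_endo_field A (J \<alpha>)) \<and>
     (\<forall>(\<alpha>, \<beta>, \<gamma>) \<in> cyclic_triples. \<forall>c\<in>A. \<forall>x \<in> coord_dom c. \<forall>u.
        J \<alpha> c x u = J \<beta> c x (J \<gamma> c x u) \<and>
        J \<alpha> c x u = - J \<gamma> c x (J \<beta> c x u) \<and>
        J \<alpha> c x (J \<alpha> c x u) = - u)"

definition hn_sign :: "nat \<Rightarrow> real" where
  "hn_sign \<alpha> = (if \<alpha> = 1 then 1 else -1)"

definition hermitian_norden_metric ::
  "('a, 'm::finite) chart set \<Rightarrow> (nat \<Rightarrow> ('a, 'm) endo_field) \<Rightarrow> ('a, 'm) bilinear_field \<Rightarrow> bool" where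
  "hermitian_norden_metric A J g \<longleftrightarrow> neutral_metric A g \<and>
     (\<forall>\<alpha> \<in> {1, 2, 3}. \<forall>c\<in>A. \<forall>x \<in> coord_dom c. \<forall>u v.
        g c x (J \<alpha> c x u) (J \<alpha> c x v) = hn_sign \<alpha> * g c x u v)"

definition quaternionic_kaehler ::
  "'a topology \<Rightarrow> ('a, 'm::finite) chart set \<Rightarrow> (nat \<Rightarrow> ('a, 'm) endo_field) \<Rightarrow>
   ('a, 'm) connection \<Rightarrow> bool" where
  "quaternionic_kaehler X A J D \<longleftrightarrow>
     (\<forall>p \<in> topspace X. \<exists>W. openin X W \<and> p \<in> W \<and>
        (\<exists>\<omega> :: nat \<Rightarrow> ('a, 'm) one_form.
           (\<forall>\<alpha> \<in> {1, 2, 3}. one_form_on A W (\<omega> \<alpha>)) \<and>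
           (\<forall>(\<alpha>, \<beta>, \<gamma>) \<in> cyclic_triples. \<forall>c\<in>A. \<forall>Y Z.
              smooth_on (coord_dom c) Y \<longrightarrow> smooth_on (coord_dom c) Z \<longrightarrow>
              (\<forall>x \<in> snd c ` (fst c \<inter> W).
                 nabla_endo (D c) (J \<alpha> c) Y Z x =
                   \<omega> \<gamma> c x (Y x) *\<^sub>R J \<beta> c x (Z x) - \<omega> \<beta> c x (Y x) *\<^sub>R J \<gamma> c x (Z x)))))"

end

theory Submission
  imports Defs
begin

text \<open>
  The metric breaks the symmetry between the three structures. \<open>J1\<close> is skew with respect to \<open>g\<close>, so
  \<open>\<nabla>J1\<close> is skew, whereas \<open>\<omega>\<^sub>3 J2 - \<omega>\<^sub>2 J3\<close> is symmetric. Hence \<open>\<omega>\<^sub>2 = \<omega>\<^sub>3 = 0\<close>, the structure \<open>J1\<close> is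
  parallel, and with \<open>\<omega> = \<omega>\<^sub>1\<close>, \<open>\<Omega> = d\<omega>\<close> the Ricci identity gives \<open>[R, J1] = 0\<close> and
  \<open>[R, J2] = \<Omega> \<otimes> J3\<close> (\<open>qk_chart_at\<close>, \<open>curv_commutator\<close>).

  The rest of the proof that the metric is Einstein is algebra at a point, in the locale
  \<open>qk_curvature_tensor\<close>. Computing the trace of \<open>J1 R(x,y)\<close> in two ways yields
  \<open>Ric(x, J1 y) = n \<Omega>(x,y)\<close>. Comparing \<open>Ric\<close> with its transform under \<open>J2\<close> gives
  \<open>Ric(J2 y, J2 z) = - Ric(y,z)\<close> as soon as \<open>n \<ge> 2\<close> (\<open>ric_J2_J2\<close>), so that \<open>\<Omega>\<close> is invariant under \<open>J2\<close>.
  The pair symmetry of the curvature then forces \<open>\<Omega>(x,y) F(z,w) = F(x,y) \<Omega>(z,w)\<close> for the fundamental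
  form \<open>F(x,y) = g(J1 x, y)\<close>. Hence \<open>\<Omega> = \<mu> F\<close> and \<open>Ric = - n \<mu> g\<close>.

  Finally \<open>\<mu>\<close> is locally constant: \<open>\<Omega>\<close> is exact and \<open>F\<close> is parallel, so both are closed, and
  \<open>d\<mu> \<and> F = 0\<close> implies \<open>d\<mu> = 0\<close> (\<open>factor_derivative_zero\<close>). Since \<open>\<Omega>\<close> and \<open>F\<close> are tensorial, \<open>\<mu>\<close> does
  not depend on the chart (\<open>qk_factor_on\<close>), which avoids transforming the Ricci tensor itself.
\<close>

section \<open>Smooth maps and the symmetry of second derivatives\<close>

lemma Ck_on_subset: "Ck_on k S f \<Longrightarrow> T \<subseteq> S \<Longrightarrow> Ck_on k T f"
  by (induction k arbitrary: f)
    (auto intro: continuous_on_subset differentiable_on_subset)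

lemma smooth_on_subset: "smooth_on S f \<Longrightarrow> T \<subseteq> S \<Longrightarrow> smooth_on T f"
  by (auto simp: smooth_on_def intro: Ck_on_subset)

lemma smooth_on_const [simp]: "smooth_on S (\<lambda>_. a)"
proof -
  have "Ck_on k S (\<lambda>_. a)" for k and a :: 'b
    by (induction k arbitrary: a) (auto simp: differentiable_on_def)
  then show ?thesis by (simp add: smooth_on_def)
qed

lemma smooth_on_imp_differentiable:
  assumes "smooth_on S f" "open S" "x \<in> S"
  shows "f differentiable (at x)"
proof -
  have "Ck_on (Suc 0) S f" using assms(1) unfolding smooth_on_def by blast
  then have "f differentiable_on S" by simp
  then show ?thesis
    using assms(2,3) by (simp add: differentiable_on_eq_differentiable_at)
qed

lemma smooth_on_imp_continuous: "smooth_on S f \<Longrightarrow> continuous_on S f"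
  unfolding smooth_on_def by (metis Ck_on.simps(1))

lemma smooth_on_partial:
  assumes "smooth_on S f"
  shows "smooth_on S (\<lambda>x. frechet_derivative f (at x) v)"
  unfolding smooth_on_def
proof
  fix k
  have "Ck_on (Suc k) S f" using assms unfolding smooth_on_def by blast
  then show "Ck_on k S (\<lambda>x. frechet_derivative f (at x) v)" by simp
qed

lemma has_derivative_frechet:
  assumes "smooth_on S f" "open S" "x \<in> S"
  shows "(f has_derivative frechet_derivative f (at x)) (at x)"
  using smooth_on_imp_differentiable[OF assms] by (simp add: frechet_derivative_works)

lemma mean_value_along_line:
  fixes f :: "'v::real_normed_vector \<Rightarrow> real"
  assumes "t > 0"
    and "\<And>s. 0 \<le> s \<Longrightarrow> s \<le> t \<Longrightarrow> (f has_derivative f' (a + s *\<^sub>R u)) (at (a + s *\<^sub>R u))"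
  obtains s where "0 < s" "s < t" "f (a + t *\<^sub>R u) - f a = t * f' (a + s *\<^sub>R u) u"
proof -
  have d: "((\<lambda>s. f (a + s *\<^sub>R u)) has_real_derivative f' (a + s *\<^sub>R u) u) (at s)"
    if "0 \<le> s" "s \<le> t" for s
  proof -
    have "((\<lambda>s. f (a + s *\<^sub>R u)) has_derivative (\<lambda>r. f' (a + s *\<^sub>R u) (r *\<^sub>R u))) (at s)"
      by (rule has_derivative_compose[of "\<lambda>s. a + s *\<^sub>R u" "\<lambda>r. r *\<^sub>R u" s UNIV f, OF _ assms(2)[OF that]])
        (auto intro!: derivative_eq_intros)
    moreover have "linear (f' (a + s *\<^sub>R u))"
      using assms(2)[OF that] by (rule has_derivative_linear)
    ultimately show ?thesis
      by (simp add: has_field_derivative_def linear_cmul mult.commute[of _ "f' _ _"])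
  qed
  obtain s where "0 < s" "s < t"
    "f (a + t *\<^sub>R u) - f (a + 0 *\<^sub>R u) = (t - 0) * f' (a + s *\<^sub>R u) u"
    using MVT2[of 0 t "\<lambda>s. f (a + s *\<^sub>R u)" "\<lambda>s. f' (a + s *\<^sub>R u) u"] d assms(1)
    by (metis less_eq_real_def)
  then show ?thesis using that by simp
qed

text \<open>The second difference of \<open>f\<close> over the parallelogram spanned by \<open>t u\<close> and \<open>t v\<close> is symmetric in
  \<open>u\<close> and \<open>v\<close>. Two applications of the mean value theorem, first along \<open>u\<close> and then along \<open>v\<close>,
  turn it into a mixed second derivative at a nearby point.\<close>

lemma second_difference_quotient:
  fixes f :: "'v::real_normed_vector \<Rightarrow> real"
  assumes f: "smooth_on (ball x r) f" and t: "t > 0" "t * (norm u + norm v) < r"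
  obtains y where "dist x y \<le> t * (norm u + norm v)"
    "f (x + t *\<^sub>R u + t *\<^sub>R v) - f (x + t *\<^sub>R u) - f (x + t *\<^sub>R v) + f x
      = t\<^sup>2 * frechet_derivative (\<lambda>z. frechet_derivative f (at z) u) (at y) v"
proof -
  define f1 where "f1 z = frechet_derivative f (at z)" for z
  define f2 where "f2 z = frechet_derivative (\<lambda>z. f1 z u) (at z)" for z
  have close: "dist x (x + s *\<^sub>R u + s' *\<^sub>R v) \<le> t * (norm u + norm v)"
    if "0 \<le> s" "s \<le> t" "0 \<le> s'" "s' \<le> t" for s s'
  proof -
    have "dist x (x + s *\<^sub>R u + s' *\<^sub>R v) = norm (s *\<^sub>R u + s' *\<^sub>R v)"
      by (metis add.assoc add_diff_cancel_left' dist_commute dist_norm)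
    also have "\<dots> \<le> s * norm u + s' * norm v"
      using norm_triangle_ineq[of "s *\<^sub>R u" "s' *\<^sub>R v"] that by simp
    also have "\<dots> \<le> t * (norm u + norm v)"
      using that by (auto simp: distrib_left intro!: add_mono mult_right_mono)
    finally show ?thesis .
  qed
  have inb: "x + s *\<^sub>R u + s' *\<^sub>R v \<in> ball x r"
    if "0 \<le> s" "s \<le> t" "0 \<le> s'" "s' \<le> t" for s s'
    using close[OF that] t by simp
  have d1: "(f has_derivative f1 z) (at z)" if "z \<in> ball x r" for z
    unfolding f1_def using has_derivative_frechet[OF f _ that] by simp
  have d2: "((\<lambda>z. f1 z u) has_derivative f2 z) (at z)" if "z \<in> ball x r" for z
    unfolding f1_def f2_def
    using has_derivative_frechet[OF smooth_on_partial[OF f] _ that] by simp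
  define h where "h z = f (z + t *\<^sub>R v) - f z" for z
  have dh: "(h has_derivative (\<lambda>w. f1 (x + s *\<^sub>R u + t *\<^sub>R v) w - f1 (x + s *\<^sub>R u) w)) (at (x + s *\<^sub>R u))"
    if "0 \<le> s" "s \<le> t" for s
  proof -
    have "((\<lambda>z. f (z + t *\<^sub>R v)) has_derivative f1 (x + s *\<^sub>R u + t *\<^sub>R v)) (at (x + s *\<^sub>R u))"
      using has_derivative_compose[of "\<lambda>z. z + t *\<^sub>R v" "\<lambda>w. w" "x + s *\<^sub>R u" UNIV f
          "f1 (x + s *\<^sub>R u + t *\<^sub>R v)", OF _ d1[OF inb[OF that, of t]]] t(1)
      by (simp add: has_derivative_add_const)
    moreover have "(f has_derivative f1 (x + s *\<^sub>R u)) (at (x + s *\<^sub>R u))"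
      using d1[OF inb[OF that, of 0]] t(1) by simp
    ultimately show ?thesis
      unfolding h_def by (rule has_derivative_diff)
  qed
  obtain s where s: "0 < s" "s < t"
    "h (x + t *\<^sub>R u) - h x = t * (f1 (x + s *\<^sub>R u + t *\<^sub>R v) u - f1 (x + s *\<^sub>R u) u)"
    using mean_value_along_line[of t h "\<lambda>z w. f1 (z + t *\<^sub>R v) w - f1 z w" x u] dh t(1) by blast
  obtain s' where s': "0 < s'" "s' < t"
    "f1 (x + s *\<^sub>R u + t *\<^sub>R v) u - f1 (x + s *\<^sub>R u) u = t * f2 (x + s *\<^sub>R u + s' *\<^sub>R v) v"
  proof (rule mean_value_along_line[of t "\<lambda>z. f1 z u" f2 "x + s *\<^sub>R u" v])
    show "((\<lambda>z. f1 z u) has_derivative f2 (x + s *\<^sub>R u + s' *\<^sub>R v)) (at (x + s *\<^sub>R u + s' *\<^sub>R v))"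
      if "0 \<le> s'" "s' \<le> t" for s'
      using d2[OF inb[of s s']] that s by simp
  qed (use t in auto)
  have "f (x + t *\<^sub>R u + t *\<^sub>R v) - f (x + t *\<^sub>R u) - f (x + t *\<^sub>R v) + f x = h (x + t *\<^sub>R u) - h x"
    by (simp add: h_def)
  also have "\<dots> = t\<^sup>2 * f2 (x + s *\<^sub>R u + s' *\<^sub>R v) v"
    using s s' by (simp add: power2_eq_square)
  finally show ?thesis
    using that[of "x + s *\<^sub>R u + s' *\<^sub>R v"] close[of s s'] s s' by (simp add: f1_def f2_def)
qed

text \<open>Schwarz: both mixed derivatives at nearby points equal the same second difference divided by \<open>t\<^sup>2\<close>;
  by continuity they agree in the limit of small \<open>t\<close>.\<close>

lemma smooth_partials_commute_real:
  fixes f :: "'v::real_normed_vector \<Rightarrow> real"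
  assumes f: "smooth_on S f" and S: "open S" "x \<in> S"
  shows "frechet_derivative (\<lambda>z. frechet_derivative f (at z) u) (at x) v =
         frechet_derivative (\<lambda>z. frechet_derivative f (at z) v) (at x) u"
proof -
  define a where "a y = frechet_derivative (\<lambda>z. frechet_derivative f (at z) u) (at y) v" for y
  define b where "b y = frechet_derivative (\<lambda>z. frechet_derivative f (at z) v) (at y) u" for y
  have "\<bar>a x - b x\<bar> \<le> e" if e: "e > 0" for e
  proof -
    have "continuous_on S a" "continuous_on S b"
      unfolding a_def b_def using f
      by (auto intro!: smooth_on_imp_continuous smooth_on_partial)
    then have "isCont a x" "isCont b x"
      using S by (auto simp: continuous_on_eq_continuous_at)
    then have "\<forall>e>0. \<exists>d>0. \<forall>y. dist y x < d \<longrightarrow> dist (a y) (a x) < e"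
      "\<forall>e>0. \<exists>d>0. \<forall>y. dist y x < d \<longrightarrow> dist (b y) (b x) < e"
      unfolding continuous_at_eps_delta by blast+
    from this[THEN spec, THEN mp, OF half_gt_zero[OF e]] obtain d1 d2
      where d: "d1 > 0" "d2 > 0" "\<And>y. dist y x < d1 \<Longrightarrow> dist (a y) (a x) < e/2"
        "\<And>y. dist y x < d2 \<Longrightarrow> dist (b y) (b x) < e/2"
      by blast
    obtain r where r: "r > 0" "ball x r \<subseteq> S" using S open_contains_ball by blast
    define q where "q = min r (min d1 d2)"
    have q: "q > 0" using r d by (simp add: q_def)
    define N where "N = norm u + norm v + 1"
    have N: "N > 0" by (simp add: add_nonneg_pos N_def)
    \<comment> \<open>small enough for the whole parallelogram to lie in the ball of radius \<open>q\<close>\<close>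
    define t where "t = q / (2 * N)"
    have t: "t > 0" using q N by (simp add: t_def)
    have "t * (norm u + norm v) \<le> t * N"
      using t by (intro mult_left_mono) (auto simp: N_def)
    also have "\<dots> = q / 2"
      using N by (simp add: t_def)
    also have "\<dots> < q" using q by simp
    finally have tq: "t * (norm u + norm v) < q" .
    have fr: "smooth_on (ball x r) f" using f r smooth_on_subset by blast
    have tr: "t * (norm u + norm v) < r" "t * (norm v + norm u) < r"
      using tq by (auto simp: q_def add.commute)
    obtain y where y: "dist x y \<le> t * (norm u + norm v)"
      "f (x + t *\<^sub>R u + t *\<^sub>R v) - f (x + t *\<^sub>R u) - f (x + t *\<^sub>R v) + f x = t\<^sup>2 * a y"
      using second_difference_quotient[OF fr t tr(1)] unfolding a_def by blast
    obtain y' where y': "dist x y' \<le> t * (norm v + norm u)"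
      "f (x + t *\<^sub>R v + t *\<^sub>R u) - f (x + t *\<^sub>R v) - f (x + t *\<^sub>R u) + f x = t\<^sup>2 * b y'"
      using second_difference_quotient[OF fr t tr(2)] unfolding b_def by blast
    have "t\<^sup>2 * a y = t\<^sup>2 * b y'"
      unfolding y(2)[symmetric] y'(2)[symmetric] by (simp add: add_ac)
    then have "a y = b y'" using t by simp
    moreover have "dist (a y) (a x) < e/2" "dist (b y') (b x) < e/2"
      using y(1) y'(1) tq
      by (intro d; simp add: q_def dist_commute[of _ x] add.commute[of "norm v"])+
    ultimately show ?thesis by (simp add: dist_real_def abs_if split: if_splits)
  qed
  then have "\<bar>a x - b x\<bar> \<le> 0" by (meson dense_ge)
  then show ?thesis by (simp add: a_def b_def)
qed

lemma frechet_derivative_inner_left: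
  assumes "f differentiable (at x)"
  shows "frechet_derivative (\<lambda>z. f z \<bullet> k) (at x) v = frechet_derivative f (at x) v \<bullet> k"
proof -
  have "((\<lambda>z. f z \<bullet> k) has_derivative (\<lambda>v. frechet_derivative f (at x) v \<bullet> k)) (at x)"
    using assms by (intro has_derivative_inner_left) (simp add: frechet_derivative_works)
  then show ?thesis by (metis frechet_derivative_at)
qed

lemma Ck_on_cong:
  assumes "open S" "\<And>x. x \<in> S \<Longrightarrow> f x = f' x"
  shows "Ck_on k S f \<longleftrightarrow> Ck_on k S f'"
proof -
  have imp: "Ck_on k S f'" if "Ck_on k S f" "\<And>x. x \<in> S \<Longrightarrow> f x = f' x" for f f'
    using that
  proof (induction k arbitrary: f f')
    case 0
    then show ?case using continuous_on_cong[of S S f f'] by simp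
  next
    case (Suc k)
    have df: "f differentiable at x" if "x \<in> S" for x
      using Suc.prems(1) that assms(1) by (simp add: differentiable_on_eq_differentiable_at)
    have d: "frechet_derivative f (at x) = frechet_derivative f' (at x)" if "x \<in> S" for x
      using frechet_derivative_transform_within_open[OF df[OF that] assms(1) that] Suc.prems(2) by blast
    have "f' differentiable_on S"
      using df has_derivative_transform_within_open[where f = f and g = f' and s = S and t = UNIV] assms(1) Suc.prems(2)
      unfolding differentiable_on_eq_differentiable_at[OF assms(1)] differentiable_def by blast
    moreover have "Ck_on k S (\<lambda>x. frechet_derivative f' (at x) v)" for v
      by (rule Suc.IH[of "\<lambda>x. frechet_derivative f (at x) v"]) (use Suc.prems(1) d in auto)
    ultimately show ?case by simp
  qed
  show ?thesis using imp[of f f'] imp[of f' f] assms(2) by auto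
qed

lemma smooth_on_inner_left:
  assumes "smooth_on S f" "open S"
  shows "smooth_on S (\<lambda>x. f x \<bullet> k)"
proof -
  have "Ck_on i S (\<lambda>x. f x \<bullet> k)" if "smooth_on S f" for i f
    using that
  proof (induction i arbitrary: f)
    case 0
    then show ?case by (auto intro!: continuous_intros dest: smooth_on_imp_continuous)
  next
    case (Suc i)
    have df: "f differentiable at x" if "x \<in> S" for x
      using Suc.prems assms(2) that by (rule smooth_on_imp_differentiable)
    have "(\<lambda>x. f x \<bullet> k) differentiable_on S"
      using df assms(2) has_derivative_inner_left
      unfolding differentiable_on_eq_differentiable_at[OF assms(2)] differentiable_def by blast
    moreover have "Ck_on i S (\<lambda>x. frechet_derivative (\<lambda>x. f x \<bullet> k) (at x) v)" for v
      using Suc.IH[OF smooth_on_partial[OF Suc.prems]] df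
        Ck_on_cong[OF assms(2), of "\<lambda>x. frechet_derivative (\<lambda>x. f x \<bullet> k) (at x) v"
          "\<lambda>x. frechet_derivative f (at x) v \<bullet> k"]
      by (simp add: frechet_derivative_inner_left)
    ultimately show ?case by simp
  qed
  then show ?thesis using assms(1) by (simp add: smooth_on_def)
qed

lemma smooth_partials_commute:
  fixes f :: "'v::real_normed_vector \<Rightarrow> 'w::real_inner"
  assumes f: "smooth_on S f" and S: "open S" "x \<in> S"
  shows "frechet_derivative (\<lambda>z. frechet_derivative f (at z) u) (at x) v =
         frechet_derivative (\<lambda>z. frechet_derivative f (at z) v) (at x) u"
proof -
  have *: "frechet_derivative (\<lambda>z. frechet_derivative (\<lambda>z. f z \<bullet> k) (at z) u) (at x) v =
      frechet_derivative (\<lambda>z. frechet_derivative f (at z) u) (at x) v \<bullet> k" for u v k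
  proof -
    have fu: "smooth_on S (\<lambda>z. frechet_derivative f (at z) u)" by (rule smooth_on_partial[OF f])
    have fk: "smooth_on S (\<lambda>z. frechet_derivative f (at z) u \<bullet> k)"
      by (rule smooth_on_inner_left[OF fu S(1)])
    have "frechet_derivative (\<lambda>z. frechet_derivative (\<lambda>z. f z \<bullet> k) (at z) u) (at x) =
        frechet_derivative (\<lambda>z. frechet_derivative f (at z) u \<bullet> k) (at x)"
      by (rule frechet_derivative_transform_within_open[OF _ S, symmetric])
        (auto simp: frechet_derivative_inner_left smooth_on_imp_differentiable[OF f S(1)]
          intro: smooth_on_imp_differentiable[OF fk S])
    then show ?thesis
      by (simp add: frechet_derivative_inner_left smooth_on_imp_differentiable[OF fu S])
  qed
  have "frechet_derivative (\<lambda>z. frechet_derivative f (at z) u) (at x) v \<bullet> k =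
      frechet_derivative (\<lambda>z. frechet_derivative f (at z) v) (at x) u \<bullet> k" for k
    using smooth_partials_commute_real[OF smooth_on_inner_left[OF f S(1)] S, of k u v]
    by (simp add: *)
  then show ?thesis by (metis inner_commute vector_eq_ldot)
qed

text \<open>The product rule for a field of linear maps applied to a vector field. Tensor fields are given
  with only their values on constant vectors known to be smooth, so the field is expanded in a basis.\<close>

lemma has_derivative_linear_field:
  fixes M :: "'v::real_normed_vector \<Rightarrow> 'e::euclidean_space \<Rightarrow> 'w::real_normed_vector"
  assumes S: "open S" "x \<in> S" and lin: "\<And>z. z \<in> S \<Longrightarrow> linear (M z)"
    and dM: "\<And>b. ((\<lambda>z. M z b) has_derivative M' b) (at x)"
    and dU: "(U has_derivative U') (at x)"
  shows "((\<lambda>z. M z (U z)) has_derivative (\<lambda>v. M' (U x) v + M x (U' v))) (at x)"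
proof -
  have ex: "M z w = (\<Sum>b\<in>Basis. (w \<bullet> b) *\<^sub>R M z b)" if "z \<in> S" for z w
    by (subst euclidean_representation[of w, symmetric])
      (simp only: linear_sum[OF lin[OF that]] linear_cmul[OF lin[OF that]])
  have ex': "M' w v = (\<Sum>b\<in>Basis. (w \<bullet> b) *\<^sub>R M' b v)" for w v
  proof -
    have "((\<lambda>z. \<Sum>b\<in>Basis. (w \<bullet> b) *\<^sub>R M z b) has_derivative (\<lambda>v. \<Sum>b\<in>Basis. (w \<bullet> b) *\<^sub>R M' b v)) (at x)"
      by (auto intro!: derivative_eq_intros dM)
    then have "((\<lambda>z. M z w) has_derivative (\<lambda>v. \<Sum>b\<in>Basis. (w \<bullet> b) *\<^sub>R M' b v)) (at x)"
      by (rule has_derivative_transform_within_open[OF _ S]) (simp add: ex[symmetric])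
    from has_derivative_unique[OF dM this] show ?thesis by (rule fun_cong)
  qed
  have "((\<lambda>z. \<Sum>b\<in>Basis. (U z \<bullet> b) *\<^sub>R M z b) has_derivative
      (\<lambda>v. \<Sum>b\<in>Basis. (U x \<bullet> b) *\<^sub>R M' b v + (U' v \<bullet> b) *\<^sub>R M x b)) (at x)"
    by (auto intro!: derivative_eq_intros dM dU)
  then have "((\<lambda>z. M z (U z)) has_derivative
      (\<lambda>v. \<Sum>b\<in>Basis. (U x \<bullet> b) *\<^sub>R M' b v + (U' v \<bullet> b) *\<^sub>R M x b)) (at x)"
    by (rule has_derivative_transform_within_open[OF _ S]) (simp add: ex[symmetric])
  then show ?thesis by (simp add: sum.distrib ex'[symmetric] ex[OF S(2), symmetric])
qed

lemma has_derivative_if_frechet_derivative_eq: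
  assumes "smooth_on S f" "open S" "x \<in> S" "\<And>u. frechet_derivative f (at x) u = f' u"
  shows "(f has_derivative f') (at x)"
proof -
  have "frechet_derivative f (at x) = f'" using assms(4) by blast
  then show ?thesis using has_derivative_frechet[OF assms(1-3)] by simp
qed

lemma frechet_derivative_eq_on_open:
  assumes "open S" "x \<in> S" "\<And>z. z \<in> S \<Longrightarrow> f z = h z"
    and "(h has_derivative h') (at x)"
  shows "frechet_derivative f (at x) = h'"
proof -
  have "(f has_derivative h') (at x)"
    using has_derivative_transform_within_open[OF assms(4,1,2)] assms(3) by simp
  then show ?thesis by (rule frechet_derivative_at[symmetric])
qed

lemma linear_frechet_derivative_of_linear_field:
  fixes M :: "'v::real_normed_vector \<Rightarrow> 'e::euclidean_space \<Rightarrow> 'w::real_normed_vector"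
  assumes S: "open S" "x \<in> S" and lin: "\<And>z. z \<in> S \<Longrightarrow> linear (M z)"
    and smooth: "\<And>b. smooth_on S (\<lambda>z. M z b)"
  shows "linear (\<lambda>b. frechet_derivative (\<lambda>z. M z b) (at x) v)"
proof (rule linearI)
  note dM = has_derivative_frechet[OF smooth S]
  show "frechet_derivative (\<lambda>z. M z (a + b)) (at x) v =
      frechet_derivative (\<lambda>z. M z a) (at x) v + frechet_derivative (\<lambda>z. M z b) (at x) v" for a b
    by (subst frechet_derivative_eq_on_open[OF S _ has_derivative_add[OF dM dM], of _ a b])
      (simp_all add: linear_add[OF lin])
  show "frechet_derivative (\<lambda>z. M z (r *\<^sub>R b)) (at x) v = r *\<^sub>R frechet_derivative (\<lambda>z. M z b) (at x) v" for r b
    by (subst frechet_derivative_eq_on_open[OF S _ has_derivative_scaleR_right[OF dM], of _ r b])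
      (simp_all add: linear_cmul[OF lin])
qed

section \<open>Traces and indefinite inner products\<close>

lemma trace_matrix: "trace (matrix f) = (\<Sum>i\<in>UNIV. f (axis i 1) $ i)"
  by (simp add: trace_def matrix_def)

lemma trace_matrix_add:
  "trace (matrix (\<lambda>x. f x + h x)) = trace (matrix f) + trace (matrix h)"
  by (simp add: trace_matrix sum.distrib)

lemma trace_matrix_diff:
  fixes f :: "real ^ 'm::finite \<Rightarrow> real ^ 'm"
  shows "trace (matrix (\<lambda>x. f x - h x)) = trace (matrix f) - trace (matrix h)"
  by (simp add: trace_matrix sum_subtractf)

lemma trace_matrix_uminus:
  fixes f :: "real ^ 'm::finite \<Rightarrow> real ^ 'm"
  shows "trace (matrix (\<lambda>x. - f x)) = - trace (matrix f)"
  by (simp add: trace_matrix sum_negf)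

lemma trace_matrix_scaleR:
  fixes f :: "real ^ 'm::finite \<Rightarrow> real ^ 'm"
  shows "trace (matrix (\<lambda>x. c *\<^sub>R f x)) = c * trace (matrix f)"
  by (simp add: trace_matrix sum_distrib_left)

lemma trace_matrix_id: "trace (matrix (\<lambda>x::real ^ 'm::finite. x)) = real CARD('m)"
  by (simp add: trace_matrix axis_def)

lemma trace_matrix_commute:
  fixes f h :: "real ^ 'm::finite \<Rightarrow> real ^ 'm"
  assumes "linear f" "linear h"
  shows "trace (matrix (\<lambda>x. f (h x))) = trace (matrix (\<lambda>x. h (f x)))"
  using matrix_compose[of f h] matrix_compose[of h f] assms trace_mul_sym[of "matrix f" "matrix h"]
  by (simp add: comp_def)

lemma linear_expand_axis:
  fixes f :: "real ^ 'm::finite \<Rightarrow> 'w::real_vector"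
  assumes "linear f"
  shows "f x = (\<Sum>i\<in>UNIV. x $ i *\<^sub>R f (axis i 1))"
  by (subst basis_expansion[of x, symmetric])
    (simp add: linear_sum[OF assms] linear_cmul[OF assms] scalar_mult_eq_scaleR)

lemma trace_matrix_rank_one:
  fixes b :: "real ^ 'm::finite"
  assumes "linear \<phi>"
  shows "trace (matrix (\<lambda>x. \<phi> x *\<^sub>R b)) = \<phi> b"
  by (subst linear_expand_axis[OF assms, of b]) (simp add: trace_matrix mult.commute)

locale pseudo_euclidean_form =
  fixes g :: "real ^ 'm::finite \<Rightarrow> real ^ 'm \<Rightarrow> real"
  assumes bil: "bilinear g" and sym: "g x y = g y x"
    and signature: "\<exists>p q. has_signature g p q"
begin

lemma lin1: "linear (\<lambda>x. g x y)" and lin2: "linear (g x)"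
  using bil by (auto simp: bilinear_def)

lemmas g_simps = linear_add[OF lin1] linear_add[OF lin2] linear_diff[OF lin1] linear_diff[OF lin2]
  linear_neg[OF lin1] linear_neg[OF lin2] linear_cmul[OF lin1] linear_cmul[OF lin2]
  linear_0[OF lin1] linear_0[OF lin2]

lemma orthonormal_basis:
  obtains e :: "'m \<Rightarrow> real ^ 'm" and s :: "'m \<Rightarrow> real"
  where "\<And>i. s i \<noteq> 0" "\<And>i. g (e i) (e i) = s i" "\<And>x. (\<Sum>i\<in>UNIV. (s i * g x (e i)) *\<^sub>R e i) = x"
proof -
  obtain e :: "'m \<Rightarrow> real ^ 'm" and P where e: "span (range e) = UNIV" "inj e"
    "\<And>i j. g (e i) (e j) = (if i = j then (if i \<in> P then 1 else -1) else 0)"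
    using signature unfolding has_signature_def by blast
  define s where "s i = (if i \<in> P then 1 else -1 :: real)" for i
  have s: "s i * s i = 1" "s i \<noteq> 0" for i by (auto simp: s_def)
  have "(\<Sum>i\<in>UNIV. (s i * g x (e i)) *\<^sub>R e i) = x" for x
  proof -
    have "x \<in> span (range e)" using e by simp
    then show ?thesis
    proof (induction rule: span_induct_alt)
      case base
      then show ?case by (simp add: g_simps)
    next
      case (step c x y)
      then obtain j where j: "x = e j" by auto
      have "(\<Sum>i\<in>UNIV. (s i * g (e j) (e i)) *\<^sub>R e i) = (\<Sum>i\<in>UNIV. if i = j then e j else 0)"
        by (rule sum.cong) (auto simp: e(3) s_def)
      also have "\<dots> = e j" by simp
      finally have "(\<Sum>i\<in>UNIV. (s i * g (e j) (e i)) *\<^sub>R e i) = e j" .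
      then have "c *\<^sub>R e j = c *\<^sub>R (\<Sum>i\<in>UNIV. (s i * g (e j) (e i)) *\<^sub>R e i)" by simp
      also have "\<dots> = (\<Sum>i\<in>UNIV. (s i * (c * g (e j) (e i))) *\<^sub>R e i)"
        by (simp add: scaleR_sum_right mult.left_commute)
      finally have "c *\<^sub>R e j + (\<Sum>i\<in>UNIV. (s i * g y (e i)) *\<^sub>R e i)
          = (\<Sum>i\<in>UNIV. (s i * (c * g (e j) (e i))) *\<^sub>R e i) + (\<Sum>i\<in>UNIV. (s i * g y (e i)) *\<^sub>R e i)"
        by simp
      also have "\<dots> = (\<Sum>i\<in>UNIV. (s i * g (c *\<^sub>R x + y) (e i)) *\<^sub>R e i)"
        by (simp add: j g_simps distrib_left scaleR_add_left sum.distrib)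
      finally show ?case using step.IH by (simp add: j)
    qed
  qed
  moreover have "g (e i) (e i) = s i" for i by (simp add: e(3) s_def)
  ultimately show ?thesis using that[of s e] s(2) by simp
qed

lemma nondegenerate:
  assumes "\<And>y. g x y = g x' y"
  shows "x = x'"
proof -
  obtain e :: "'m \<Rightarrow> real ^ 'm" and s
    where e: "\<And>x. (\<Sum>i\<in>UNIV. (s i * g x (e i)) *\<^sub>R e i) = x"
    by (rule orthonormal_basis) (rule that)
  have "x = (\<Sum>i\<in>UNIV. (s i * g x (e i)) *\<^sub>R e i)" by (rule e[symmetric])
  also have "\<dots> = (\<Sum>i\<in>UNIV. (s i * g x' (e i)) *\<^sub>R e i)" by (simp only: assms)
  also have "\<dots> = x'" by (rule e)
  finally show ?thesis .
qed

lemma exists_non_null: "\<exists>u. g u u \<noteq> 0"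
proof -
  obtain e :: "'m \<Rightarrow> real ^ 'm" and s where "\<And>i. s i \<noteq> 0" "\<And>i. g (e i) (e i) = s i"
    by (rule orthonormal_basis) (rule that)
  then have "g (e undefined) (e undefined) \<noteq> 0" by simp
  then show ?thesis by blast
qed

lemma riesz_representation:
  assumes "linear \<phi>"
  shows "\<exists>b. \<forall>y. \<phi> y = g b y"
proof -
  obtain e :: "'m \<Rightarrow> real ^ 'm" and s
    where e: "\<And>x. (\<Sum>i\<in>UNIV. (s i * g x (e i)) *\<^sub>R e i) = x"
    by (rule orthonormal_basis) (rule that)
  have "\<phi> y = g (\<Sum>i\<in>UNIV. (s i * \<phi> (e i)) *\<^sub>R e i) y" for y
  proof -
    have "\<phi> y = \<phi> (\<Sum>i\<in>UNIV. (s i * g y (e i)) *\<^sub>R e i)" by (simp only: e)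
    also have "\<dots> = (\<Sum>i\<in>UNIV. s i * g y (e i) * \<phi> (e i))"
      by (simp add: linear_sum[OF assms] linear_cmul[OF assms])
    also have "\<dots> = (\<Sum>i\<in>UNIV. s i * \<phi> (e i) * g (e i) y)"
      by (simp only: sym[of y] mult_ac)
    also have "\<dots> = g (\<Sum>i\<in>UNIV. (s i * \<phi> (e i)) *\<^sub>R e i) y"
      by (simp add: linear_sum[OF lin1] linear_cmul[OF lin1])
    finally show ?thesis .
  qed
  then show ?thesis by blast
qed

text \<open>In an orthonormal basis the trace is \<open>\<Sum>i. s i * g (f (e i)) (e i)\<close>, which does not see the
  difference between \<open>f\<close> and its adjoint.\<close>

lemma trace_adjoint:
  assumes f: "linear f" and h: "linear h" and adj: "\<And>x y. g (f x) y = g x (h y)"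
  shows "trace (matrix f) = trace (matrix h)"
proof -
  obtain e :: "'m \<Rightarrow> real ^ 'm" and s where e: "\<And>x. (\<Sum>i\<in>UNIV. (s i * g x (e i)) *\<^sub>R e i) = x"
    by (rule orthonormal_basis) (rule that)
  have tr: "trace (matrix k) = (\<Sum>i\<in>UNIV. s i * g (k (e i)) (e i))" if k: "linear k" for k
  proof -
    have "k = (\<lambda>x. \<Sum>i\<in>UNIV. (s i * g (k x) (e i)) *\<^sub>R e i)"
      by (rule ext) (rule e[symmetric])
    then have "trace (matrix k) = trace (matrix (\<lambda>x. \<Sum>i\<in>UNIV. (s i * g (k x) (e i)) *\<^sub>R e i))"
      by simp
    also have "\<dots> = (\<Sum>i\<in>UNIV. trace (matrix (\<lambda>x. (s i * g (k x) (e i)) *\<^sub>R e i)))"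
      unfolding trace_matrix sum_component by (rule sum.swap)
    also have "\<dots> = (\<Sum>i\<in>UNIV. s i * g (k (e i)) (e i))"
    proof (rule sum.cong[OF refl])
      fix i
      have "linear (\<lambda>x. s i * g (k x) (e i))"
        using linear_compose[OF k lin1[of "e i"]] linear_compose_scale_right[of "\<lambda>x. g (k x) (e i)" "s i"]
        by (simp add: comp_def)
      then show "trace (matrix (\<lambda>x. (s i * g (k x) (e i)) *\<^sub>R e i)) = s i * g (k (e i)) (e i)"
        by (rule trace_matrix_rank_one)
    qed
    finally show ?thesis .
  qed
  show ?thesis
    unfolding tr[OF f] tr[OF h] by (simp only: adj sym[of "h _"])
qed

end

section \<open>Hermitian-Norden structures on a vector space\<close>

locale hermitian_norden_space = pseudo_euclidean_form g
  for g :: "real ^ 'm::finite \<Rightarrow> real ^ 'm \<Rightarrow> real" +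
  fixes J1 J2 :: "real ^ 'm \<Rightarrow> real ^ 'm"
  assumes J1_lin: "linear J1" and J2_lin: "linear J2"
    and J1_sq: "J1 (J1 x) = - x" and J2_sq: "J2 (J2 x) = - x"
    and J2_J1: "J2 (J1 x) = - J1 (J2 x)"
    and g_J1: "g (J1 x) (J1 y) = g x y" and g_J2: "g (J2 x) (J2 y) = - g x y"
begin

lemmas J_simps = linear_add[OF J1_lin] linear_add[OF J2_lin] linear_diff[OF J1_lin] linear_diff[OF J2_lin]
  linear_neg[OF J1_lin] linear_neg[OF J2_lin] linear_cmul[OF J1_lin] linear_cmul[OF J2_lin]
  linear_0[OF J1_lin] linear_0[OF J2_lin]

lemma g_J1_skew: "g (J1 x) y = - g x (J1 y)"
  using g_J1[of x "J1 y"] by (simp add: J1_sq g_simps)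

lemma g_J2_sym: "g (J2 x) y = g x (J2 y)"
  using g_J2[of x "J2 y"] by (simp add: J2_sq g_simps)

lemma fundamental_form_nonzero: "\<exists>z w. g (J1 z) w \<noteq> 0"
  using exists_non_null J1_sq g_J1 by metis

text \<open>Wedging a 1-form with the fundamental form \<open>F x y = g (J1 x) y\<close> is injective in dimension above
  \<open>2\<close>. With \<open>b\<close> dual to \<open>\<phi>\<close>, the identity \<open>\<phi> \<and> F = 0\<close> expresses \<open>\<phi> w\<close> times the identity as an
  endomorphism of rank at most two whose trace is \<open>2 * \<phi> w\<close>; comparing traces gives
  \<open>(dim - 2) * \<phi> w = 0\<close>.\<close>

lemma wedge_fundamental_form_injective:
  assumes \<phi>: "linear \<phi>" and dim: "CARD('m) > 2"
    and cyc: "\<And>u v w. \<phi> w * g (J1 u) v + \<phi> u * g (J1 v) w + \<phi> v * g (J1 w) u = 0"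
  shows "\<phi> w = 0"
proof -
  obtain b where b: "\<And>y. \<phi> y = g b y" using riesz_representation[OF \<phi>] by blast
  have F_skew: "g (J1 x) y = - g (J1 y) x" for x y
    using g_J1_skew[of x y] sym[of x "J1 y"] by simp
  have "\<phi> w *\<^sub>R J1 x = \<phi> x *\<^sub>R J1 w + g (J1 x) w *\<^sub>R b" for x
  proof (rule nondegenerate)
    show "g (\<phi> w *\<^sub>R J1 x) y = g (\<phi> x *\<^sub>R J1 w + g (J1 x) w *\<^sub>R b) y" for y
      using cyc[of w x y] F_skew[of y w] F_skew[of w x]
      by (simp add: g_simps b[symmetric] algebra_simps)
  qed
  from arg_cong[OF this, of J1]
  have "\<phi> w *\<^sub>R x = \<phi> x *\<^sub>R w - g (J1 x) w *\<^sub>R J1 b" for x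
    by (simp add: J_simps J1_sq) (metis add.commute minus_diff_eq minus_minus uminus_add_conv_diff)
  then have "(\<lambda>x. \<phi> w *\<^sub>R x) = (\<lambda>x. \<phi> x *\<^sub>R w - g (J1 x) w *\<^sub>R J1 b)"
    by blast
  then have "trace (matrix (\<lambda>x::real ^ 'm. \<phi> w *\<^sub>R x))
      = trace (matrix (\<lambda>x. \<phi> x *\<^sub>R w - g (J1 x) w *\<^sub>R J1 b))"
    by (rule arg_cong[where f = "\<lambda>h. trace (matrix h)"])
  moreover have "linear (\<lambda>x. g (J1 x) w)"
    using linear_compose[OF J1_lin lin1[of w]] by (simp add: comp_def)
  ultimately have "\<phi> w * CARD('m) = \<phi> w - g (J1 (J1 b)) w"
    by (simp only: trace_matrix_diff trace_matrix_scaleR trace_matrix_id trace_matrix_rank_one \<phi>)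
  also have "\<dots> = 2 * \<phi> w" by (simp add: J1_sq g_simps b)
  finally show ?thesis using dim by simp
qed

text \<open>Linear independence of \<open>J2\<close> and \<open>J3 = J1 J2\<close>: for \<open>g u u \<noteq> 0\<close>, pairing the combination at \<open>u\<close> with
  \<open>J2 u\<close> sees only the coefficient of \<open>J2\<close>, because \<open>g (J1 u) u = 0\<close>.\<close>

lemma norden_combination_eq_0:
  assumes "\<And>w z. a * g (J2 w) z - b * g (J1 (J2 w)) z = 0"
  shows "a = 0 \<and> b = 0"
proof -
  obtain u where u: "g u u \<noteq> 0" using exists_non_null by blast
  have *: "g (J1 u) u = 0" using g_J1_skew[of u u] sym[of u "J1 u"] by simp
  have "a = 0" using assms[of u "J2 u"] u *
    by (simp add: g_J2 g_J2_sym[symmetric] J2_J1 J2_sq g_simps J_simps)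
  moreover have "b = 0"
    using assms[of u "J1 (J2 u)"] u * \<open>a = 0\<close> by (simp add: g_J1 g_J2)
  ultimately show ?thesis by simp
qed

end

section \<open>Quaternionic Kaehler curvature tensors\<close>

text \<open>The algebra of the curvature at one point. The commutation rules say that \<open>J1\<close> is parallel and
  that \<open>J2\<close> and \<open>J3 = J1 J2\<close> rotate into each other with curvature form \<open>\<Omega>\<close>; see \<open>qk_chart\<close> below.\<close>

locale qk_curvature_tensor = hermitian_norden_space g J1 J2
  for g :: "real ^ 'm::finite \<Rightarrow> real ^ 'm \<Rightarrow> real" and J1 J2 +
  fixes R :: "real ^ 'm \<Rightarrow> real ^ 'm \<Rightarrow> real ^ 'm \<Rightarrow> real ^ 'm"
    and \<Omega> :: "real ^ 'm \<Rightarrow> real ^ 'm \<Rightarrow> real"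
    and n :: nat
  assumes dim: "CARD('m) = 4 * n" and n_ge_2: "n \<ge> 2"
    and R_lin1: "linear (\<lambda>x. R x y z)" and R_lin3: "linear (R x y)"
    and R_skew: "R y x z = - R x y z"
    and bianchi: "R x y z + R y z x + R z x y = 0"
    and R_metric: "g (R x y z) w = - g z (R x y w)"
    and R_J1: "R x y (J1 z) = J1 (R x y z)"
    and R_J2: "R x y (J2 z) = J2 (R x y z) + \<Omega> x y *\<^sub>R J1 (J2 z)"
    and \<Omega>_lin: "linear (\<lambda>x. \<Omega> x y)"
begin

definition ric where "ric y z = trace (matrix (\<lambda>x. R x y z))"

lemma R_lin2: "linear (\<lambda>y. R x y z)"
proof -
  have "(\<lambda>y. R x y z) = (\<lambda>y. - R y x z)" using R_skew by blast
  then show ?thesis using R_lin1 linear_compose_neg by metis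
qed

lemmas R_simps = linear_add[OF R_lin1] linear_add[OF R_lin2] linear_add[OF R_lin3]
  linear_neg[OF R_lin1] linear_neg[OF R_lin2] linear_neg[OF R_lin3]

text \<open>The usual consequence of the first Bianchi identity: add its four cyclic instances.\<close>

lemma pair_symmetry: "g (R x y z) w = g (R z w x) y"
proof -
  have b: "g (R x y z) w + g (R y z x) w + g (R z x y) w = 0" for x y z w
    using arg_cong[OF bianchi[of x y z], of "\<lambda>v. g v w"] by (simp add: g_simps)
  have s1: "g (R y x z) w = - g (R x y z) w" for x y z w
    by (subst R_skew) (simp add: g_simps)
  have s2: "g (R x y w) z = - g (R x y z) w" for x y z w
    by (simp add: R_metric[of x y z w] sym[of z])
  show ?thesis
    using b[of y z x w] b[of z x w y] b[of x w y z] b[of w y z x]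
      s2[of z x y w] s2[of y z x w] s2[of x w z y] s2[of w y x z]
      s1[of z w x y] s2[of z w x y] s1[of x y w z] s2[of x y z w]
    by linarith
qed

lemma ric_sym: "ric y z = ric z y"
proof -
  have "g (R x y z) w = g x (R w z y)" for x w
    using pair_symmetry[of x y z w] R_metric[of z w x y] R_skew[of z w y] by (simp add: g_simps)
  then show ?thesis unfolding ric_def by (intro trace_adjoint R_lin1)
qed

lemma R_J1_J1: "R (J1 x) (J1 y) z = R x y z"
proof (rule nondegenerate)
  show "g (R (J1 x) (J1 y) z) w = g (R x y z) w" for w
    by (simp add: pair_symmetry[of _ _ z w] R_J1 g_J1)
qed

lemma ric_J1_J1: "ric (J1 y) (J1 z) = ric y z"
proof -
  have "ric (J1 y) (J1 z) = trace (matrix (\<lambda>x. J1 (R x (J1 y) z)))"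
    by (simp add: ric_def R_J1)
  also have "\<dots> = trace (matrix (\<lambda>x. R (J1 x) (J1 y) z))"
    using R_lin1 by (intro trace_matrix_commute[OF J1_lin])
  finally show ?thesis by (simp add: R_J1_J1 ric_def)
qed

text \<open>The Kaehler identity for the Ricci form: the first Bianchi identity splits \<open>J1 R(x,y)\<close> into two
  endomorphisms whose traces are values of the Ricci tensor.\<close>

lemma trace_J1_R_eq_ric: "trace (matrix (\<lambda>z. J1 (R x y z))) = - 2 * ric x (J1 y)"
proof -
  have "R x y z = R z y x - R z x y" for z
  proof -
    have "R x y z = - (R y z x + R z x y)"
      using bianchi[of x y z] by (simp only: eq_neg_iff_add_eq_0 add.assoc)
    moreover have "R y z x = - R z y x" by (rule R_skew)
    ultimately show ?thesis by simp
  qed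
  then have "trace (matrix (\<lambda>z. J1 (R x y z))) = trace (matrix (\<lambda>z. R z y (J1 x) - R z x (J1 y)))"
    by (simp add: J_simps R_J1)
  also have "\<dots> = ric y (J1 x) - ric x (J1 y)"
    by (simp only: trace_matrix_diff ric_def)
  also have "ric y (J1 x) = - ric x (J1 y)"
  proof -
    have "ric y (J1 x) = ric (J1 y) (J1 (J1 x))" by (simp only: ric_J1_J1)
    also have "\<dots> = - ric (J1 y) x"
      by (simp add: ric_def J1_sq R_simps trace_matrix_uminus)
    finally show ?thesis by (simp add: ric_sym)
  qed
  finally show ?thesis by simp
qed

text \<open>\<open>R(x,y)\<close> is the sum of \<open>(\<Omega> x y / 2) J1\<close> and an endomorphism commuting with \<open>J1\<close> and \<open>J2\<close>. The
  product of the latter with \<open>J1\<close> is conjugate under \<open>J2\<close> to its own negative, hence traceless, and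
  only \<open>\<Omega>\<close> contributes.\<close>

lemma trace_J1_R_eq_\<Omega>: "trace (matrix (\<lambda>z. J1 (R x y z))) = - 2 * real n * \<Omega> x y"
proof -
  have "J1 (R x y z) = - J1 (J2 (R x y (J2 z))) - \<Omega> x y *\<^sub>R z" for z
  proof -
    have "J2 (R x y (J2 z)) = - R x y z + \<Omega> x y *\<^sub>R J1 z"
      by (simp add: R_J2 J_simps J2_sq J2_J1)
    then show ?thesis by (simp add: J_simps J1_sq)
  qed
  then have "trace (matrix (\<lambda>z. J1 (R x y z)))
      = - trace (matrix (\<lambda>z. J1 (J2 (R x y (J2 z))))) - \<Omega> x y * (4 * n)"
    by (simp only: trace_matrix_diff trace_matrix_uminus trace_matrix_scaleR trace_matrix_id dim)
  also have "trace (matrix (\<lambda>z. J1 (J2 (R x y (J2 z))))) = trace (matrix (\<lambda>z. J2 (J1 (J2 (R x y z)))))"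
  proof -
    have "linear (\<lambda>z. J1 (J2 (R x y z)))"
      using linear_compose[OF linear_compose[OF R_lin3 J2_lin] J1_lin] by (simp add: comp_def)
    from trace_matrix_commute[OF this J2_lin] show ?thesis .
  qed
  also have "\<dots> = trace (matrix (\<lambda>z. J1 (R x y z)))"
    by (simp add: J2_J1 J2_sq J_simps)
  finally show ?thesis by simp
qed

lemma ric_eq_\<Omega>: "ric x (J1 y) = n * \<Omega> x y"
  using trace_J1_R_eq_ric[of x y] trace_J1_R_eq_\<Omega>[of x y] by simp

lemma \<Omega>_eq_ric: "\<Omega> x y = ric x (J1 y) / n"
  using n_ge_2 by (simp add: ric_eq_\<Omega>)

lemma ric_uminus: "ric x (- y) = - ric x y" "ric (- x) y = - ric x y"
  by (simp_all add: ric_def R_simps trace_matrix_uminus)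

lemma R_J2_J2: "g (R (J2 x) (J2 y) z) w = - g (R x y z) w + g (J1 x) y * \<Omega> z w"
proof -
  have "g (R (J2 x) (J2 y) z) w = g (J2 (R z w x) + \<Omega> z w *\<^sub>R J1 (J2 x)) (J2 y)"
    by (simp add: pair_symmetry[of _ _ z w] R_J2)
  also have "\<dots> = - g (R z w x) y + \<Omega> z w * g (J1 x) y"
  proof -
    have "J1 (J2 x) = - J2 (J1 x)" by (simp add: J2_J1)
    then show ?thesis by (simp add: g_simps g_J2)
  qed
  finally show ?thesis by (simp add: pair_symmetry[of z w] mult.commute)
qed

text \<open>Moving \<open>J2\<close> through the curvature in both pairs of arguments expresses
  \<open>ric (J2 y) (J2 z) + ric y z\<close> through \<open>\<Omega>\<close>, and \<open>ric_eq_\<Omega>\<close> turns this into \<open>1 / n\<close> times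
  the same quantity. So it vanishes for \<open>n \<ge> 2\<close>, while \<open>n = 1\<close> gives no information: here the
  dimension bound enters.\<close>

lemma ric_J2_J2: "ric (J2 y) (J2 z) = - ric y z"
proof -
  have "ric (J2 y) (J2 z) = trace (matrix (\<lambda>x. J2 (R x (J2 y) z) + \<Omega> x (J2 y) *\<^sub>R J1 (J2 z)))"
    by (simp add: ric_def R_J2)
  also have "\<dots> = trace (matrix (\<lambda>x. J2 (R x (J2 y) z))) + \<Omega> (J1 (J2 z)) (J2 y)"
    by (simp only: trace_matrix_add trace_matrix_rank_one[OF \<Omega>_lin])
  also have "trace (matrix (\<lambda>x. J2 (R x (J2 y) z))) = trace (matrix (\<lambda>x. R (J2 x) (J2 y) z))"
    by (intro trace_matrix_commute J2_lin R_lin1)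
  also have "\<dots> = trace (matrix (\<lambda>w. - R w z y + \<Omega> w z *\<^sub>R J1 y))"
  proof (rule trace_adjoint)
    show "linear (\<lambda>x. R (J2 x) (J2 y) z)"
      using linear_compose[OF J2_lin R_lin1] by (simp add: comp_def)
    show "linear (\<lambda>w. - R w z y + \<Omega> w z *\<^sub>R J1 y)"
      by (rule linearI) (simp_all add: R_simps linear_cmul[OF R_lin1] linear_add[OF \<Omega>_lin]
          linear_cmul[OF \<Omega>_lin] algebra_simps)
    fix x w
    have "ric w (J1 z) = - ric z (J1 w)"
      using ric_J1_J1[of "J1 w" z] ric_sym[of "J1 w" z] by (simp add: J1_sq ric_uminus)
    then have "\<Omega> w z = - \<Omega> z w"
      by (simp add: \<Omega>_eq_ric)
    then show "g (R (J2 x) (J2 y) z) w = g x (- R w z y + \<Omega> w z *\<^sub>R J1 y)"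
      using pair_symmetry[of x y z w] R_metric[of z w x y] R_skew[of z w y]
      by (simp add: R_J2_J2 g_simps g_J1_skew)
  qed
  also have "\<dots> = - ric z y + \<Omega> (J1 y) z"
    by (simp only: trace_matrix_add trace_matrix_uminus trace_matrix_rank_one[OF \<Omega>_lin] ric_def)
  also have "\<dots> = - ric y z + ric y z / n"
    by (simp add: \<Omega>_eq_ric ric_J1_J1 ric_sym)
  also have "\<Omega> (J1 (J2 z)) (J2 y) = ric (J2 y) (J2 z) / n"
    by (simp add: \<Omega>_eq_ric ric_J1_J1 ric_sym)
  finally have "ric (J2 y) (J2 z) + ric y z = ric (J2 y) (J2 z) / n + ric y z / n"
    by linarith
  moreover have "(a + b) * (1 - 1 / n) = (a + b) - (a / n + b / n)" for a b :: real
    by (simp add: right_diff_distrib add_divide_distrib)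
  ultimately have "(ric (J2 y) (J2 z) + ric y z) * (1 - 1 / n) = 0"
    by (metis diff_self)
  then show ?thesis using n_ge_2 by (auto simp: eq_neg_iff_add_eq_0)
qed

lemma \<Omega>_J2_J2: "\<Omega> (J2 x) (J2 y) = \<Omega> x y"
proof -
  have "J1 (J2 y) = - J2 (J1 y)" by (simp add: J2_J1)
  then show ?thesis by (simp add: \<Omega>_eq_ric ric_uminus ric_J2_J2)
qed

text \<open>Compute \<open>g (R (J2 x) (J2 y) (J2 z)) (J2 w)\<close> by removing \<open>J2\<close> from the two pairs of arguments in
  either order.\<close>

lemma \<Omega>_proportional: "\<Omega> x y * g (J1 z) w = g (J1 x) y * \<Omega> z w"
proof -
  have F: "g (J1 (J2 z)) (J2 w) = g (J1 z) w"
    using J2_J1[of z] g_J2[of "J1 z" w] by (simp add: g_simps)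
  have "g (R (J2 x) (J2 y) (J2 z)) (J2 w)
      = - (- g (R x y z) w + g (J1 x) y * \<Omega> z w) + \<Omega> x y * g (J1 z) w"
    using R_J2_J2[of x y z w] by (simp add: R_J2 g_simps g_J2 \<Omega>_J2_J2 F)
  moreover have "g (R (J2 x) (J2 y) (J2 z)) (J2 w)
      = g (R x y z) w - \<Omega> x y * g (J1 z) w + g (J1 x) y * \<Omega> z w"
    unfolding R_J2_J2 by (simp add: R_J2 g_simps g_J2 \<Omega>_J2_J2 F)
  ultimately show ?thesis by linarith
qed

lemma einstein_at_point:
  "\<exists>\<mu>::real. (\<forall>x y. \<Omega> x y = \<mu> * g (J1 x) y) \<and> (\<forall>y z. ric y z = - (real n * \<mu>) * g y z)"
proof -
  obtain z w where zw: "g (J1 z) w \<noteq> 0" using fundamental_form_nonzero by blast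
  define l where "l = \<Omega> z w / g (J1 z) w"
  have l: "\<Omega> x y = l * g (J1 x) y" for x y
    using \<Omega>_proportional[of x y z w] zw by (simp add: l_def field_simps)
  have "ric y z = - (real n * l) * g y z" for y z
    using ric_eq_\<Omega>[of y "J1 z"] by (simp add: J1_sq ric_uminus l g_J1)
  then show ?thesis using l by blast
qed

end

section \<open>Curvature of a torsion-free connection in coordinates\<close>

text \<open>The coordinate formula of the curvature in terms of Christoffel symbols.\<close>

definition curv ::
  "(real ^ 'm \<Rightarrow> real ^ 'm \<Rightarrow> real ^ 'm \<Rightarrow> real ^ 'm) \<Rightarrow>
   real ^ 'm \<Rightarrow> real ^ 'm \<Rightarrow> real ^ 'm \<Rightarrow> real ^ 'm \<Rightarrow> real ^ 'm" where
  "curv \<Gamma> x u v w =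
     frechet_derivative (\<lambda>z. \<Gamma> z v w) (at x) u - frechet_derivative (\<lambda>z. \<Gamma> z u w) (at x) v
     + \<Gamma> x u (\<Gamma> x v w) - \<Gamma> x v (\<Gamma> x u w)"

definition ext_deriv :: "(real ^ 'm \<Rightarrow> real ^ 'm \<Rightarrow> real) \<Rightarrow> real ^ 'm \<Rightarrow> real ^ 'm \<Rightarrow> real ^ 'm \<Rightarrow> real" where
  "ext_deriv \<omega> x u v =
     frechet_derivative (\<lambda>z. \<omega> z v) (at x) u - frechet_derivative (\<lambda>z. \<omega> z u) (at x) v"

lemma curvature_const:
  assumes "bilinear (\<Gamma> x)"
  shows "curvature \<Gamma> (\<lambda>_. u) (\<lambda>_. v) (\<lambda>_. w) x = curv \<Gamma> x u v w"
  using bilinear_lzero[OF assms] by (simp add: curvature_def nabla_def lie_bracket_def curv_def)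

lemma ext_deriv_closed:
  assumes S: "open S" "x \<in> S" and \<omega>: "\<And>u. smooth_on S (\<lambda>z. \<omega> z u)"
  shows "frechet_derivative (\<lambda>z. ext_deriv \<omega> z u v) (at x) w
       + frechet_derivative (\<lambda>z. ext_deriv \<omega> z v w) (at x) u
       + frechet_derivative (\<lambda>z. ext_deriv \<omega> z w u) (at x) v = 0"
proof -
  have "frechet_derivative (\<lambda>z. ext_deriv \<omega> z u v) (at x) w =
      frechet_derivative (\<lambda>z. frechet_derivative (\<lambda>z. \<omega> z v) (at z) u) (at x) w -
      frechet_derivative (\<lambda>z. frechet_derivative (\<lambda>z. \<omega> z u) (at z) v) (at x) w" for u v w
    unfolding ext_deriv_def
    by (rule fun_cong[OF frechet_derivative_at[symmetric]])
      (intro has_derivative_diff has_derivative_frechet[OF smooth_on_partial[OF \<omega>] S])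
  then show ?thesis
    using smooth_partials_commute[OF \<omega> S] by simp
qed

locale chart_connection =
  fixes S :: "(real ^ 'm::finite) set" and \<Gamma> :: "real ^ 'm \<Rightarrow> real ^ 'm \<Rightarrow> real ^ 'm \<Rightarrow> real ^ 'm"
  assumes S: "open S"
    and \<Gamma>_bil: "z \<in> S \<Longrightarrow> bilinear (\<Gamma> z)"
    and \<Gamma>_smooth: "smooth_on S (\<lambda>z. \<Gamma> z u v)"
    and \<Gamma>_sym: "z \<in> S \<Longrightarrow> \<Gamma> z u v = \<Gamma> z v u"
begin

lemma \<Gamma>_lin1: "z \<in> S \<Longrightarrow> linear (\<lambda>u. \<Gamma> z u v)" and \<Gamma>_lin2: "z \<in> S \<Longrightarrow> linear (\<Gamma> z u)"
  using \<Gamma>_bil by (auto simp: bilinear_def)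

lemmas \<Gamma>_has_derivative = has_derivative_frechet[OF \<Gamma>_smooth S]

lemma curv_lin1:
  assumes x: "x \<in> S"
  shows "linear (\<lambda>u. curv \<Gamma> x u v w)"
proof (rule linearI)
  note lin = linear_frechet_derivative_of_linear_field[OF S x \<Gamma>_lin1 \<Gamma>_smooth, of w v]
    has_derivative_linear[OF \<Gamma>_has_derivative[OF x], of v w]
  show "curv \<Gamma> x (a + b) v w = curv \<Gamma> x a v w + curv \<Gamma> x b v w" for a b
    using lin[THEN linear_add] \<Gamma>_lin1[OF x, THEN linear_add] \<Gamma>_lin2[OF x, THEN linear_add]
    by (simp add: curv_def)
  show "curv \<Gamma> x (r *\<^sub>R b) v w = r *\<^sub>R curv \<Gamma> x b v w" for r b
    using lin[THEN linear_cmul] \<Gamma>_lin1[OF x, THEN linear_cmul] \<Gamma>_lin2[OF x, THEN linear_cmul]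
    by (simp add: curv_def algebra_simps)
qed

lemma curv_lin3:
  assumes x: "x \<in> S"
  shows "linear (curv \<Gamma> x u v)"
proof (rule linearI)
  note lin = linear_frechet_derivative_of_linear_field[OF S x \<Gamma>_lin2 \<Gamma>_smooth]
  show "curv \<Gamma> x u v (a + b) = curv \<Gamma> x u v a + curv \<Gamma> x u v b" for a b
    using lin[THEN linear_add] \<Gamma>_lin2[OF x, THEN linear_add]
    by (simp add: curv_def)
  show "curv \<Gamma> x u v (r *\<^sub>R b) = r *\<^sub>R curv \<Gamma> x u v b" for r b
    using lin[THEN linear_cmul] \<Gamma>_lin2[OF x, THEN linear_cmul]
    by (simp add: curv_def algebra_simps)
qed

lemma curv_skew: "curv \<Gamma> x v u w = - curv \<Gamma> x u v w"
  by (simp add: curv_def)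

lemma curv_bianchi:
  assumes x: "x \<in> S"
  shows "curv \<Gamma> x u v w + curv \<Gamma> x v w u + curv \<Gamma> x w u v = 0"
proof -
  have "frechet_derivative (\<lambda>z. \<Gamma> z u v) (at x) = frechet_derivative (\<lambda>z. \<Gamma> z v u) (at x)" for u v
    by (rule frechet_derivative_eq_on_open[OF S x \<Gamma>_sym \<Gamma>_has_derivative[OF x]])
  from this[of u v] this[of v w] this[of w u] show ?thesis
    using \<Gamma>_sym[OF x, of u v] \<Gamma>_sym[OF x, of v w] \<Gamma>_sym[OF x, of w u]
    by (simp add: curv_def)
qed

text \<open>Second derivatives of \<open>g z w y\<close> commute; writing them out with the Christoffel symbols, the
  antisymmetric part is \<open>g (R w) y + g w (R y)\<close>.\<close>

lemma curv_metric:
  fixes g :: "real ^ 'm \<Rightarrow> real ^ 'm \<Rightarrow> real ^ 'm \<Rightarrow> real"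
  assumes x: "x \<in> S"
    and bil: "\<And>z. z \<in> S \<Longrightarrow> bilinear (g z)" and smooth: "\<And>v w. smooth_on S (\<lambda>z. g z v w)"
    and parallel: "\<And>z u v w. z \<in> S \<Longrightarrow>
      frechet_derivative (\<lambda>z. g z v w) (at z) u = g z (\<Gamma> z u v) w + g z v (\<Gamma> z u w)"
  shows "g x (curv \<Gamma> x u v w) y = - g x w (curv \<Gamma> x u v y)"
proof -
  define \<Gamma>' where "\<Gamma>' v w = frechet_derivative (\<lambda>z. \<Gamma> z v w) (at x)" for v w
  define g' where "g' a b u = g x (\<Gamma> x u a) b + g x a (\<Gamma> x u b)" for a b u
  have g': "((\<lambda>z. g z a b) has_derivative g' a b) (at x)" for a b
    by (rule has_derivative_if_frechet_derivative_eq[OF smooth S x]) (simp add: parallel[OF x] g'_def)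
  note \<Gamma>' = \<Gamma>_has_derivative[OF x, folded \<Gamma>'_def]
  have "frechet_derivative (\<lambda>z. frechet_derivative (\<lambda>z. g z w y) (at z) v) (at x) u =
      g' (\<Gamma> x v w) y u + g x (\<Gamma>' v w u) y + (g' w (\<Gamma> x v y) u + g x w (\<Gamma>' v y u))" for u v
  proof -
    have "((\<lambda>z. g z (\<Gamma> z v w) y) has_derivative (\<lambda>u. g' (\<Gamma> x v w) y u + g x (\<Gamma>' v w u) y)) (at x)"
      by (rule has_derivative_linear_field[where M = "\<lambda>z a. g z a y", OF S x _ g' \<Gamma>'])
        (use bil in \<open>auto simp: bilinear_def\<close>)
    moreover have "((\<lambda>z. g z w (\<Gamma> z v y)) has_derivative (\<lambda>u. g' w (\<Gamma> x v y) u + g x w (\<Gamma>' v y u))) (at x)"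
      by (rule has_derivative_linear_field[where M = "\<lambda>z a. g z w a", OF S x _ g' \<Gamma>'])
        (use bil in \<open>auto simp: bilinear_def\<close>)
    ultimately have "((\<lambda>z. g z (\<Gamma> z v w) y + g z w (\<Gamma> z v y)) has_derivative
        (\<lambda>u. g' (\<Gamma> x v w) y u + g x (\<Gamma>' v w u) y + (g' w (\<Gamma> x v y) u + g x w (\<Gamma>' v y u)))) (at x)"
      by (rule has_derivative_add)
    from frechet_derivative_eq_on_open[OF S x parallel this] show ?thesis by simp
  qed
  from this[of u v] this[of v u] smooth_partials_commute[OF smooth S x, of w y v u]
  have "g' (\<Gamma> x v w) y u + g x (\<Gamma>' v w u) y + (g' w (\<Gamma> x v y) u + g x w (\<Gamma>' v y u)) =
      g' (\<Gamma> x u w) y v + g x (\<Gamma>' u w v) y + (g' w (\<Gamma> x u y) v + g x w (\<Gamma>' u y v))"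
    by simp
  moreover have lin: "linear (\<lambda>a. g x a y)" "linear (g x w)" using bil[OF x] by (auto simp: bilinear_def)
  ultimately show ?thesis
    by (simp add: curv_def linear_add[OF lin(1)] linear_diff[OF lin(1)] linear_add[OF lin(2)]
        linear_diff[OF lin(2)] g'_def \<Gamma>'_def[symmetric])
qed

text \<open>The Ricci identity for an endomorphism field with \<open>\<nabla>E = \<theta> \<otimes> K\<close> and, at the point, \<open>\<nabla>K = \<kappa> \<otimes> E\<close>:
  the commutator of \<open>R\<close> with \<open>E\<close> is \<open>d\<theta> \<otimes> K\<close>, because the remaining term \<open>(\<theta> \<and> \<kappa>) \<otimes> E\<close> vanishes when
  \<open>\<theta>\<close> and \<open>\<kappa>\<close> are proportional. Again this is the symmetry of the second derivatives of \<open>E z w\<close>.\<close>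

lemma curv_commutator:
  fixes E K :: "real ^ 'm \<Rightarrow> real ^ 'm \<Rightarrow> real ^ 'm"
  assumes x: "x \<in> S"
    and E_lin: "\<And>z. z \<in> S \<Longrightarrow> linear (E z)" and E_smooth: "\<And>w. smooth_on S (\<lambda>z. E z w)"
    and \<theta>_smooth: "\<And>v. smooth_on S (\<lambda>z. \<theta> z v)"
    and dE: "\<And>z u w. z \<in> S \<Longrightarrow> frechet_derivative (\<lambda>z. E z w) (at z) u
      = E z (\<Gamma> z u w) - \<Gamma> z u (E z w) + \<theta> z u *\<^sub>R K z w"
    and dK: "\<And>w. ((\<lambda>z. K z w) has_derivative
      (\<lambda>u. K x (\<Gamma> x u w) - \<Gamma> x u (K x w) + \<kappa> u *\<^sub>R E x w)) (at x)"
    and parallel: "\<And>u v. \<theta> x u * \<kappa> v = \<theta> x v * \<kappa> u"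
  shows "curv \<Gamma> x u v (E x w) = E x (curv \<Gamma> x u v w) + ext_deriv \<theta> x u v *\<^sub>R K x w"
proof -
  define \<Gamma>' where "\<Gamma>' v w = frechet_derivative (\<lambda>z. \<Gamma> z v w) (at x)" for v w
  define \<theta>' where "\<theta>' v = frechet_derivative (\<lambda>z. \<theta> z v) (at x)" for v
  define E' where "E' w u = E x (\<Gamma> x u w) - \<Gamma> x u (E x w) + \<theta> x u *\<^sub>R K x w" for w u
  define K' where "K' w u = K x (\<Gamma> x u w) - \<Gamma> x u (K x w) + \<kappa> u *\<^sub>R E x w" for w u
  have E': "((\<lambda>z. E z a) has_derivative E' a) (at x)" for a
    by (rule has_derivative_if_frechet_derivative_eq[OF E_smooth S x]) (simp add: dE[OF x] E'_def)
  note \<Gamma>' = \<Gamma>_has_derivative[OF x, folded \<Gamma>'_def]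
  note \<theta>' = has_derivative_frechet[OF \<theta>_smooth S x, folded \<theta>'_def]
  have K': "((\<lambda>z. K z a) has_derivative K' a) (at x)" for a
    using dK[of a] unfolding K'_def .
  have "frechet_derivative (\<lambda>z. frechet_derivative (\<lambda>z. E z w) (at z) v) (at x) u =
      (E' (\<Gamma> x v w) u + E x (\<Gamma>' v w u)) - (\<Gamma>' v (E x w) u + \<Gamma> x v (E' w u))
      + (\<theta> x v *\<^sub>R K' w u + \<theta>' v u *\<^sub>R K x w)" for u v
  proof -
    have "((\<lambda>z. E z (\<Gamma> z v w) - \<Gamma> z v (E z w) + \<theta> z v *\<^sub>R K z w) has_derivative
        (\<lambda>u. (E' (\<Gamma> x v w) u + E x (\<Gamma>' v w u)) - (\<Gamma>' v (E x w) u + \<Gamma> x v (E' w u))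
        + (\<theta> x v *\<^sub>R K' w u + \<theta>' v u *\<^sub>R K x w))) (at x)"
      by (intro has_derivative_add has_derivative_diff has_derivative_scaleR \<theta>' K'
          has_derivative_linear_field[OF S x E_lin E' \<Gamma>']
          has_derivative_linear_field[OF S x \<Gamma>_lin2 \<Gamma>' E'])
    from frechet_derivative_eq_on_open[OF S x dE this] show ?thesis by simp
  qed
  from this[of u v] this[of v u] smooth_partials_commute[OF E_smooth S x, of w v u]
  have "(E' (\<Gamma> x v w) u + E x (\<Gamma>' v w u)) - (\<Gamma>' v (E x w) u + \<Gamma> x v (E' w u))
      + (\<theta> x v *\<^sub>R K' w u + \<theta>' v u *\<^sub>R K x w)
    = (E' (\<Gamma> x u w) v + E x (\<Gamma>' u w v)) - (\<Gamma>' u (E x w) v + \<Gamma> x u (E' w v))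
      + (\<theta> x u *\<^sub>R K' w v + \<theta>' u v *\<^sub>R K x w)"
    by simp
  moreover have "\<kappa> v * \<theta> x u = \<kappa> u * \<theta> x v"
    using parallel[of u v] by (simp only: mult.commute)
  ultimately show ?thesis
    using E_lin[OF x] \<Gamma>_lin2[OF x]
    by (simp add: curv_def ext_deriv_def linear_add linear_diff linear_cmul E'_def K'_def
        \<Gamma>'_def[symmetric] \<theta>'_def[symmetric] algebra_simps)
qed

text \<open>The covariant derivative \<open>N\<close> of a skew endomorphism field in a fixed direction is skew:
  differentiate the identity \<open>g (E a) b + g a (E b) = 0\<close>.\<close>

lemma covariant_derivative_of_skew_is_skew:
  fixes g :: "real ^ 'm \<Rightarrow> real ^ 'm \<Rightarrow> real ^ 'm \<Rightarrow> real"
  assumes x: "x \<in> S"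
    and bil: "\<And>z. z \<in> S \<Longrightarrow> bilinear (g z)" and smooth: "\<And>v w. smooth_on S (\<lambda>z. g z v w)"
    and g_parallel: "\<And>v w u. frechet_derivative (\<lambda>z. g z v w) (at x) u
      = g x (\<Gamma> x u v) w + g x v (\<Gamma> x u w)"
    and E_smooth: "\<And>w. smooth_on S (\<lambda>z. E z w)"
    and skew: "\<And>z a b. z \<in> S \<Longrightarrow> g z (E z a) b = - g z a (E z b)"
    and dE: "\<And>w. frechet_derivative (\<lambda>z. E z w) (at x) u = E x (\<Gamma> x u w) - \<Gamma> x u (E x w) + N w"
  shows "g x (N a) b = - g x a (N b)"
proof -
  have lin1: "linear (\<lambda>v. g z v w)" and lin2: "linear (g z v)" if "z \<in> S" for z v w
    using bil[OF that] by (auto simp: bilinear_def)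
  have dg: "((\<lambda>z. g z v w) has_derivative (\<lambda>u. g x (\<Gamma> x u v) w + g x v (\<Gamma> x u w))) (at x)" for v w
    by (rule has_derivative_if_frechet_derivative_eq[OF smooth S x g_parallel])
  define E' where "E' w = frechet_derivative (\<lambda>z. E z w) (at x)" for w
  have dE': "((\<lambda>z. E z w) has_derivative E' w) (at x)" for w
    unfolding E'_def by (rule has_derivative_frechet[OF E_smooth S x])
  have "((\<lambda>z. g z (E z a) b) has_derivative
      (\<lambda>v. (g x (\<Gamma> x v (E x a)) b + g x (E x a) (\<Gamma> x v b)) + g x (E' a v) b)) (at x)"
    by (rule has_derivative_linear_field[where M = "\<lambda>z v. g z v b", OF S x lin1 dg dE'])
  moreover have "((\<lambda>z. g z a (E z b)) has_derivative
      (\<lambda>v. (g x (\<Gamma> x v a) (E x b) + g x a (\<Gamma> x v (E x b))) + g x a (E' b v))) (at x)"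
    by (rule has_derivative_linear_field[where M = "\<lambda>z v. g z a v", OF S x lin2 dg dE'])
  ultimately have d: "((\<lambda>z. g z (E z a) b + g z a (E z b)) has_derivative
      (\<lambda>v. (g x (\<Gamma> x v (E x a)) b + g x (E x a) (\<Gamma> x v b)) + g x (E' a v) b +
        ((g x (\<Gamma> x v a) (E x b) + g x a (\<Gamma> x v (E x b))) + g x a (E' b v)))) (at x)"
    by (rule has_derivative_add)
  have "0 = g z (E z a) b + g z a (E z b)" if "z \<in> S" for z
    using skew[OF that] by simp
  from fun_cong[OF frechet_derivative_eq_on_open[OF S x this d], of u] show ?thesis
    using skew[OF x, of a "\<Gamma> x u b"] skew[OF x, of "\<Gamma> x u a" b]
    by (simp add: E'_def dE linear_add[OF lin1[OF x]] linear_diff[OF lin1[OF x]]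
        linear_add[OF lin2[OF x]] linear_diff[OF lin2[OF x]])
qed

end

section \<open>Quaternionic Kaehler metrics in a chart\<close>

text \<open>A quaternionic Kaehler metric in one chart, with the equations \<open>\<nabla>J1 = 0\<close> and \<open>\<nabla>J2 = \<omega> \<otimes> J1 J2\<close> that
  remain once the other two connection forms are known to vanish.\<close>

locale qk_chart = chart_connection S \<Gamma>
  for S :: "(real ^ 'm::finite) set" and \<Gamma> +
  fixes g :: "real ^ 'm \<Rightarrow> real ^ 'm \<Rightarrow> real ^ 'm \<Rightarrow> real"
    and J1 J2 :: "real ^ 'm \<Rightarrow> real ^ 'm \<Rightarrow> real ^ 'm"
    and \<omega> :: "real ^ 'm \<Rightarrow> real ^ 'm \<Rightarrow> real"
    and n :: nat
  assumes dim: "CARD('m) = 4 * n" and n_ge_2: "n \<ge> 2"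
    and hn: "z \<in> S \<Longrightarrow> hermitian_norden_space (g z) (J1 z) (J2 z)"
    and g_smooth: "smooth_on S (\<lambda>z. g z v w)"
    and J1_smooth: "smooth_on S (\<lambda>z. J1 z w)" and J2_smooth: "smooth_on S (\<lambda>z. J2 z w)"
    and \<omega>_smooth: "smooth_on S (\<lambda>z. \<omega> z w)" and \<omega>_lin: "z \<in> S \<Longrightarrow> linear (\<omega> z)"
    and g_parallel: "z \<in> S \<Longrightarrow>
      frechet_derivative (\<lambda>z. g z v w) (at z) u = g z (\<Gamma> z u v) w + g z v (\<Gamma> z u w)"
    and J1_parallel: "z \<in> S \<Longrightarrow>
      frechet_derivative (\<lambda>z. J1 z w) (at z) u = J1 z (\<Gamma> z u w) - \<Gamma> z u (J1 z w)"
    and J2_derivative: "z \<in> S \<Longrightarrow>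
      frechet_derivative (\<lambda>z. J2 z w) (at z) u
        = J2 z (\<Gamma> z u w) - \<Gamma> z u (J2 z w) + \<omega> z u *\<^sub>R J1 z (J2 z w)"
begin

abbreviation "\<Omega> \<equiv> ext_deriv \<omega>"

lemma J1_linear: "z \<in> S \<Longrightarrow> linear (J1 z)" and J2_linear: "z \<in> S \<Longrightarrow> linear (J2 z)"
  using hn by (auto simp: hermitian_norden_space_def hermitian_norden_space_axioms_def)

lemma g_bil: "z \<in> S \<Longrightarrow> bilinear (g z)"
  using hn by (auto simp: hermitian_norden_space_def pseudo_euclidean_form_def)

lemma g_lin1: "z \<in> S \<Longrightarrow> linear (\<lambda>v. g z v w)"
  using g_bil by (simp add: bilinear_def)

lemma g_has_derivative:
  assumes x: "x \<in> S"
  shows "((\<lambda>z. g z v w) has_derivative (\<lambda>u. g x (\<Gamma> x u v) w + g x v (\<Gamma> x u w))) (at x)"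
  by (rule has_derivative_if_frechet_derivative_eq[OF g_smooth S x g_parallel[OF x]])

lemma J1_has_derivative:
  assumes x: "x \<in> S"
  shows "((\<lambda>z. J1 z w) has_derivative (\<lambda>u. J1 x (\<Gamma> x u w) - \<Gamma> x u (J1 x w))) (at x)"
  by (rule has_derivative_if_frechet_derivative_eq[OF J1_smooth S x J1_parallel[OF x]])

lemma J2_has_derivative:
  assumes x: "x \<in> S"
  shows "((\<lambda>z. J2 z w) has_derivative
    (\<lambda>u. J2 x (\<Gamma> x u w) - \<Gamma> x u (J2 x w) + \<omega> x u *\<^sub>R J1 x (J2 x w))) (at x)"
  by (rule has_derivative_if_frechet_derivative_eq[OF J2_smooth S x J2_derivative[OF x]])

lemma qk_curvature_tensor_at:
  assumes x: "x \<in> S"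
  shows "qk_curvature_tensor (g x) (J1 x) (J2 x) (curv \<Gamma> x) (\<Omega> x) n"
proof -
  interpret hermitian_norden_space "g x" "J1 x" "J2 x" using hn[OF x] .
  show ?thesis
  proof (intro qk_curvature_tensor.intro qk_curvature_tensor_axioms.intro)
    show "hermitian_norden_space (g x) (J1 x) (J2 x)" by (rule hn[OF x])
    show "CARD('m) = 4 * n" "2 \<le> n" by (rule dim n_ge_2)+
    show "linear (\<lambda>u. curv \<Gamma> x u v w)" "linear (curv \<Gamma> x u v)" for u v w
      by (rule curv_lin1[OF x] curv_lin3[OF x])+
    show "curv \<Gamma> x v u w = - curv \<Gamma> x u v w" for u v w by (rule curv_skew)
    show "curv \<Gamma> x u v w + curv \<Gamma> x v w u + curv \<Gamma> x w u v = 0" for u v w by (rule curv_bianchi[OF x])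
    show "g x (curv \<Gamma> x u v w) y = - g x w (curv \<Gamma> x u v y)" for u v w y
      by (rule curv_metric[OF x g_bil g_smooth g_parallel])
    show "curv \<Gamma> x u v (J1 x w) = J1 x (curv \<Gamma> x u v w)" for u v w
    proof -
      have "curv \<Gamma> x u v (J1 x w) = J1 x (curv \<Gamma> x u v w) + ext_deriv (\<lambda>_ _. 0) x u v *\<^sub>R J1 x w"
      proof (rule curv_commutator[OF x J1_linear J1_smooth, where \<kappa> = "\<lambda>_. 0"])
        show "((\<lambda>z. J1 z w) has_derivative
          (\<lambda>u. J1 x (\<Gamma> x u w) - \<Gamma> x u (J1 x w) + 0 *\<^sub>R J1 x w)) (at x)" for w
          using J1_has_derivative[OF x, of w] by simp
      qed (simp_all add: J1_parallel)
      then show ?thesis by (simp add: ext_deriv_def)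
    qed
    show "curv \<Gamma> x u v (J2 x w) = J2 x (curv \<Gamma> x u v w) + \<Omega> x u v *\<^sub>R J1 x (J2 x w)" for u v w
    \<comment> \<open>\<open>K = J1 J2\<close>, whose derivative is \<open>- \<omega> \<otimes> J2\<close>, is again a multiple of \<open>\<omega>\<close>\<close>
    proof (rule curv_commutator[OF x J2_linear J2_smooth \<omega>_smooth J2_derivative, where \<kappa> = "\<lambda>u. - \<omega> x u"])
      fix w
      show "((\<lambda>z. J1 z (J2 z w)) has_derivative
          (\<lambda>u. J1 x (J2 x (\<Gamma> x u w)) - \<Gamma> x u (J1 x (J2 x w)) + - \<omega> x u *\<^sub>R J2 x w)) (at x)"
        using has_derivative_linear_field[OF S x J1_linear J1_has_derivative[OF x] J2_has_derivative[OF x], of w]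
        by (simp add: J_simps J1_sq algebra_simps)
    qed (auto)
    show "linear (\<lambda>u. \<Omega> x u v)" for v
      unfolding ext_deriv_def
      by (intro linear_compose_sub linear_frechet_derivative_of_linear_field[OF S x \<omega>_lin \<omega>_smooth]
          has_derivative_linear[OF has_derivative_frechet[OF \<omega>_smooth S x]])
  qed
qed

lemma einstein_factor:
  assumes x: "x \<in> S"
  shows "\<exists>\<mu>::real. (\<forall>u v. \<Omega> x u v = \<mu> * g x (J1 x u) v) \<and> (\<forall>v w. ricci \<Gamma> x v w = - (real n * \<mu>) * g x v w)"
proof -
  interpret qk_curvature_tensor "g x" "J1 x" "J2 x" "curv \<Gamma> x" "\<Omega> x" n
    by (rule qk_curvature_tensor_at[OF x])
  have "ricci \<Gamma> x = ric"
    by (intro ext) (simp add: ricci_def ric_def curvature_const \<Gamma>_bil[OF x])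
  then show ?thesis using einstein_at_point by simp
qed

text \<open>The fundamental form is parallel, since \<open>g\<close> and \<open>J1\<close> are; in coordinates this leaves only the
  Christoffel terms.\<close>

lemma fundamental_form_has_derivative:
  assumes x: "x \<in> S"
  shows "((\<lambda>z. g z (J1 z u) v) has_derivative
     (\<lambda>w. g x (J1 x u) (\<Gamma> x w v) + g x (J1 x (\<Gamma> x w u)) v)) (at x)"
proof -
  interpret hermitian_norden_space "g x" "J1 x" "J2 x" using hn[OF x] .
  show ?thesis
    using has_derivative_linear_field[where M = "\<lambda>z a. g z a v",
        OF S x g_lin1 g_has_derivative[OF x] J1_has_derivative[OF x], of u]
    by (simp add: g_simps algebra_simps)
qed

text \<open>Both \<open>\<Omega> = d\<omega>\<close> and the fundamental form \<open>F\<close> are closed, the latter because it is parallel and the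
  connection is torsion-free. Differentiating \<open>\<Omega> = l F\<close> therefore leaves \<open>dl \<and> F = 0\<close>, whence \<open>dl = 0\<close>.\<close>

lemma factor_derivative_zero:
  assumes l: "\<And>z u v. z \<in> S \<Longrightarrow> \<Omega> z u v = l z * g z (J1 z u) v" and x: "x \<in> S"
  shows "(l has_derivative (\<lambda>_. 0)) (at x)"
proof -
  interpret hermitian_norden_space "g x" "J1 x" "J2 x" using hn[OF x] .
  define F where "F z u v = g z (J1 z u) v" for z u v
  define F' where "F' u v w = g x (J1 x u) (\<Gamma> x w v) + g x (J1 x (\<Gamma> x w u)) v" for u v w
  have F': "((\<lambda>z. F z u v) has_derivative F' u v) (at x)" for u v
    unfolding F_def F'_def by (rule fundamental_form_has_derivative[OF x])
  have \<Omega>_diff: "(\<lambda>z. \<Omega> z u v) differentiable (at x)" for u v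
    unfolding ext_deriv_def
    by (intro differentiable_diff smooth_on_imp_differentiable[OF smooth_on_partial[OF \<omega>_smooth] S x])
  obtain u0 v0 where uv: "F x u0 v0 \<noteq> 0" using fundamental_form_nonzero unfolding F_def by blast
  \<comment> \<open>near \<open>x\<close> the factor is a quotient of differentiable functions\<close>
  have "isCont (\<lambda>z. F z u0 v0) x" using F' by (rule has_derivative_continuous)
  then have "\<forall>\<^sub>F z in at x. F z u0 v0 \<noteq> 0"
    using uv tendsto_imp_eventually_ne[of "\<lambda>z. F z u0 v0"] by (simp add: isCont_def)
  then have "\<forall>\<^sub>F z in nhds x. F z u0 v0 \<noteq> 0"
    using uv by (simp add: eventually_nhds_conv_at)
  moreover have "\<forall>\<^sub>F z in nhds x. z \<in> S" using S x by (rule eventually_nhds_in_open)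
  ultimately have "\<forall>\<^sub>F z in nhds x. \<Omega> z u0 v0 / F z u0 v0 = l z"
    by eventually_elim (simp add: l F_def)
  then obtain T where T: "open T" "x \<in> T" "\<And>z. z \<in> T \<Longrightarrow> \<Omega> z u0 v0 / F z u0 v0 = l z"
    unfolding eventually_nhds by blast
  have "(\<lambda>z. \<Omega> z u0 v0 / F z u0 v0) differentiable (at x)"
    using \<Omega>_diff differentiableI[OF F'] uv by (intro differentiable_divide)
  then obtain l' where "((\<lambda>z. \<Omega> z u0 v0 / F z u0 v0) has_derivative l') (at x)"
    unfolding differentiable_def by blast
  then have l': "(l has_derivative l') (at x)"
    by (rule has_derivative_transform_within_open) (use T in auto)
  have d\<Omega>: "frechet_derivative (\<lambda>z. \<Omega> z u v) (at x) w = l x * F' u v w + l' w * F x u v" for u v w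
    by (subst frechet_derivative_eq_on_open[OF S x _ has_derivative_mult[OF l' F']])
      (simp_all add: l F_def)
  have F_skew: "g x (J1 x a) b = - g x (J1 x b) a" for a b
    using g_J1_skew[of a b] sym[of a "J1 x b"] by simp
  have "F' u v w + F' v w u + F' w u v = 0" for u v w
    unfolding F'_def using F_skew[of u "\<Gamma> x w v"] F_skew[of v "\<Gamma> x u w"] F_skew[of w "\<Gamma> x v u"]
      \<Gamma>_sym[OF x, of u v] \<Gamma>_sym[OF x, of v w] \<Gamma>_sym[OF x, of u w] by simp
  then have F'_cyc: "l x * F' u v w + l x * F' v w u + l x * F' w u v = 0" for u v w
    by (metis distrib_left mult_zero_right)
  have "l' w * F x u v + l' u * F x v w + l' v * F x w u = 0" for u v w
    using ext_deriv_closed[where \<omega> = \<omega> and u = u and v = v and w = w, OF S x \<omega>_smooth] F'_cyc[of u v w] by (simp add: d\<Omega>)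
  then have cyc: "l' w * g x (J1 x u) v + l' u * g x (J1 x v) w + l' v * g x (J1 x w) u = 0" for u v w
    unfolding F_def .
  have "l' w = 0" for w
    by (rule wedge_fundamental_form_injective[OF has_derivative_linear[OF l'] _ cyc])
      (use dim n_ge_2 in linarith)
  then have "l' = (\<lambda>_. 0)" by blast
  then show ?thesis using l' by simp
qed

end

section \<open>Charts and locally constant functions\<close>

lemma locally_constant_imp_constant_on_connected:
  assumes loc: "\<And>p. p \<in> topspace X \<Longrightarrow> \<exists>U. openin X U \<and> p \<in> U \<and> (\<forall>q\<in>U. k q = k p)"
    and C: "connectedin X C"
  shows "k constant_on C"
proof (cases "C = {}")
  case True
  then show ?thesis by (simp add: constant_on_def)
next
  case False
  then obtain a where a: "a \<in> C" by blast
  have CX: "C \<subseteq> topspace X" using C by (rule connectedin_subset_topspace)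
  have op: "openin X {q \<in> topspace X. P (k q)}" for P
  proof (subst openin_subopen, clarify)
    fix p assume p: "p \<in> topspace X" "P (k p)"
    then obtain U where U: "openin X U" "p \<in> U" "\<forall>q\<in>U. k q = k p" using loc by blast
    have "U \<subseteq> {q \<in> topspace X. P (k q)}"
    proof
      fix q assume "q \<in> U"
      then have "k q = k p" "q \<in> topspace X" using U openin_subset by blast+
      then show "q \<in> {q \<in> topspace X. P (k q)}" using p(2) by simp
    qed
    then show "\<exists>T. openin X T \<and> p \<in> T \<and> T \<subseteq> {q \<in> topspace X. P (k q)}"
      using U by blast
  qed
  have "k b = k a" if b: "b \<in> C" for b
  proof (rule ccontr)
    assume "k b \<noteq> k a"
    then show False
      using connectedinD[OF C op[of "\<lambda>r. r = k a"] op[of "\<lambda>r. r \<noteq> k a"]] a b CX by blast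
  qed
  then show ?thesis unfolding constant_on_def by blast
qed

lemma chart_inj: "is_chart X c \<Longrightarrow> inj_on (snd c) (fst c)"
  unfolding is_chart_def
  by (metis homeomorphic_imp_injective_map inf.absorb2 openin_subset topspace_subtopology)

lemma param_chart: "is_chart X c \<Longrightarrow> p \<in> fst c \<Longrightarrow> param c (snd c p) = p"
  unfolding param_def by (intro inv_into_f_f chart_inj)

lemma open_chart_image:
  assumes c: "is_chart X c" and W: "openin X W"
  shows "open (snd c ` (fst c \<inter> W))"
proof -
  have "open_map (subtopology X (fst c)) (top_of_set (coord_dom c)) (snd c)"
    using c homeomorphic_imp_open_map unfolding is_chart_def by blast
  then have "openin (top_of_set (coord_dom c)) (snd c ` (fst c \<inter> W))"
    using W by (simp add: open_map_def openin_subtopology_Int2)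
  then show ?thesis
    using c openin_open_trans unfolding is_chart_def by blast
qed

lemma openin_chart_preimage:
  assumes c: "is_chart X c" and T: "open T"
  shows "openin X {q \<in> fst c. snd c q \<in> T}"
proof -
  have "continuous_map (subtopology X (fst c)) (top_of_set (coord_dom c)) (snd c)"
    using c homeomorphic_imp_continuous_map unfolding is_chart_def by blast
  moreover have "openin (top_of_set (coord_dom c)) (coord_dom c \<inter> T)"
    using T by (simp add: openin_open_Int)
  ultimately have "openin (subtopology X (fst c)) {q \<in> topspace (subtopology X (fst c)). snd c q \<in> coord_dom c \<inter> T}"
    by (rule openin_continuous_map_preimage)
  moreover have "{q \<in> topspace (subtopology X (fst c)). snd c q \<in> coord_dom c \<inter> T} = {q \<in> fst c. snd c q \<in> T}"
    using c openin_subset unfolding is_chart_def coord_dom_def by fastforce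
  ultimately show ?thesis
    using c openin_trans_full unfolding is_chart_def by (metis openin_open_subtopology)
qed

text \<open>Exterior differentiation commutes with the change of coordinates: the second derivatives of the
  transition map enter symmetrically and cancel.\<close>

lemma ext_deriv_natural:
  assumes A: "smooth_manifold X A" and W: "openin X W" and \<omega>: "one_form_on A W \<omega>"
    and cc: "c \<in> A" "c' \<in> A" and p: "p \<in> fst c" "p \<in> fst c'" "p \<in> W"
  shows "ext_deriv (\<omega> c') (snd c' p) (jac c c' (snd c p) u) (jac c c' (snd c p) v)
    = ext_deriv (\<omega> c) (snd c p) u v"
proof -
  have ch: "is_chart X c" "is_chart X c'" using A cc by (auto simp: smooth_manifold_def)
  define \<phi> where "\<phi> = transition c c'"
  define T where "T = snd c ` (fst c \<inter> (fst c' \<inter> W))"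
  have "openin X (fst c' \<inter> W)" using ch(2) W by (auto simp: is_chart_def)
  then have T: "open T" unfolding T_def by (rule open_chart_image[OF ch(1)])
  have "smooth_on (snd c ` (fst c \<inter> fst c')) \<phi>"
    using A cc by (simp add: smooth_manifold_def \<phi>_def)
  then have \<phi>: "smooth_on T \<phi>" by (rule smooth_on_subset) (auto simp: T_def)
  define x where "x = snd c p"
  have x: "x \<in> T" using p by (auto simp: x_def T_def)
  have \<phi>x: "\<phi> x = snd c' p" by (simp add: x_def \<phi>_def transition_def param_chart[OF ch(1) p(1)])
  define S' where "S' = snd c' ` (fst c' \<inter> W)"
  have S': "open S'" unfolding S'_def by (rule open_chart_image[OF ch(2) W])
  have \<phi>S': "\<phi> x \<in> S'" using p by (auto simp: \<phi>x S'_def)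
  have \<omega>': "\<And>y. y \<in> S' \<Longrightarrow> linear (\<omega> c' y)" "\<And>u. smooth_on S' (\<lambda>y. \<omega> c' y u)"
    using \<omega> cc by (auto simp: one_form_on_def S'_def)
  have pull: "\<omega> c z w = \<omega> c' (\<phi> z) (jac c c' z w)" if "z \<in> T" for z w
    using \<omega> cc that ch(1) by (auto simp: one_form_on_def T_def \<phi>_def transition_def param_chart)
  have jac: "jac c c' z = frechet_derivative \<phi> (at z)" for z by (simp add: jac_def \<phi>_def)
  define H where "H w = frechet_derivative (\<lambda>z. jac c c' z w) (at x)" for w
  have jac': "((\<lambda>z. jac c c' z w) has_derivative H w) (at x)" for w
    unfolding H_def jac by (rule has_derivative_frechet[OF smooth_on_partial[OF \<phi>] T x])
  have H_sym: "H v u = H u v"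
    unfolding H_def jac by (rule smooth_partials_commute[OF \<phi> T x])
  have "frechet_derivative (\<lambda>z. \<omega> c z w) (at x) u =
     frechet_derivative (\<lambda>y. \<omega> c' y (jac c c' x w)) (at (\<phi> x)) (jac c c' x u) + \<omega> c' (\<phi> x) (H w u)" for u w
  proof -
    define B where "B b = frechet_derivative (\<lambda>y. \<omega> c' y b) (at (\<phi> x))" for b
    have "((\<lambda>z. \<omega> c' (\<phi> z) b) has_derivative (\<lambda>u. B b (jac c c' x u))) (at x)" for b
      unfolding B_def jac
      by (rule has_derivative_compose[OF has_derivative_frechet[OF \<phi> T x] has_derivative_frechet[OF \<omega>'(2) S' \<phi>S']])
    moreover have "linear (\<omega> c' (\<phi> z))" if "z \<in> T" for z
    proof -
      obtain q where "q \<in> fst c" "q \<in> fst c'" "q \<in> W" "z = snd c q" using \<open>z \<in> T\<close> by (auto simp: T_def)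
      then have "\<phi> z \<in> S'" by (simp add: \<phi>_def transition_def param_chart[OF ch(1)] S'_def)
      then show ?thesis by (rule \<omega>'(1))
    qed
    ultimately have "((\<lambda>z. \<omega> c' (\<phi> z) (jac c c' z w)) has_derivative
        (\<lambda>u. B (jac c c' x w) (jac c c' x u) + \<omega> c' (\<phi> x) (H w u))) (at x)"
      using has_derivative_linear_field[where M = "\<lambda>z. \<omega> c' (\<phi> z)" and M' = "\<lambda>b u. B b (jac c c' x u)",
          OF T x _ _ jac'[of w]]
      by blast
    from frechet_derivative_eq_on_open[OF T x pull this] show ?thesis by (simp add: B_def)
  qed
  then show ?thesis
    unfolding ext_deriv_def x_def[symmetric] \<phi>x[symmetric] by (simp add: H_sym)
qed

section \<open>Quaternionic Kaehler manifolds\<close>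

lemma cyclic_triples_mem:
  "(1, 2, 3) \<in> cyclic_triples" "(2, 3, 1) \<in> cyclic_triples" "(3, 1, 2) \<in> cyclic_triples"
  by (simp_all add: cyclic_triples_def)

locale qk_manifold =
  fixes X :: "'a topology"
    and A :: "('a, 'm::finite) chart set"
    and J :: "nat \<Rightarrow> ('a, 'm) endo_field"
    and g :: "('a, 'm) bilinear_field"
    and D :: "('a, 'm) connection"
    and n :: nat
  assumes mfd: "smooth_manifold X A"
    and dim: "CARD('m) = 4 * n" and dim_ge: "4 * n \<ge> 8"
    and ahc: "almost_hypercomplex A J"
    and hn: "hermitian_norden_metric A J g"
    and lc: "levi_civita A g D"
    and qk: "quaternionic_kaehler X A J D"
begin

text \<open>The local 1-forms of the quaternionic Kaehler condition, named separately because the same forms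
  have to be read in several charts.\<close>

definition qk_forms :: "'a set \<Rightarrow> (nat \<Rightarrow> ('a, 'm) one_form) \<Rightarrow> bool" where
  "qk_forms W \<omega> \<longleftrightarrow>
     (\<forall>\<alpha> \<in> {1, 2, 3}. one_form_on A W (\<omega> \<alpha>)) \<and>
     (\<forall>(\<alpha>, \<beta>, \<gamma>) \<in> cyclic_triples. \<forall>c\<in>A. \<forall>Y Z.
        smooth_on (coord_dom c) Y \<longrightarrow> smooth_on (coord_dom c) Z \<longrightarrow>
        (\<forall>x \<in> snd c ` (fst c \<inter> W).
           nabla_endo (D c) (J \<alpha> c) Y Z x =
             \<omega> \<gamma> c x (Y x) *\<^sub>R J \<beta> c x (Z x) - \<omega> \<beta> c x (Y x) *\<^sub>R J \<gamma> c x (Z x)))"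

lemma obtain_chart:
  assumes "p \<in> topspace X"
  obtains c where "c \<in> A" "p \<in> fst c"
proof -
  have "p \<in> (\<Union>c\<in>A. fst c)" using mfd assms by (simp add: smooth_manifold_def)
  then show ?thesis using that by blast
qed

lemma obtain_qk_forms:
  assumes "p \<in> topspace X"
  obtains W \<omega> where "openin X W" "p \<in> W" "qk_forms W \<omega>"
proof -
  have "\<exists>W. openin X W \<and> p \<in> W \<and> (\<exists>\<omega>. qk_forms W \<omega>)"
    using qk assms unfolding quaternionic_kaehler_def qk_forms_def by (rule bspec)
  then show ?thesis using that by blast
qed

lemma quaternion_relations:
  assumes "(\<alpha>, \<beta>, \<gamma>) \<in> cyclic_triples" "c \<in> A" "x \<in> coord_dom c"
  shows "J \<alpha> c x u = J \<beta> c x (J \<gamma> c x u)" "J \<alpha> c x u = - J \<gamma> c x (J \<beta> c x u)"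
    "J \<alpha> c x (J \<alpha> c x u) = - u"
  using ahc assms unfolding almost_hypercomplex_def by blast+

lemma hermitian_norden_space_at:
  assumes c: "c \<in> A" and x: "x \<in> coord_dom c"
  shows "hermitian_norden_space (g c x) (J 1 c x) (J 2 c x)"
proof -
  have lin: "linear (J 1 c x)" "linear (J 2 c x)"
    using ahc c x by (auto simp: almost_hypercomplex_def is_endo_field_def)
  have bil: "bilinear (g c x)" and sym: "\<And>u v. g c x u v = g c x v u"
    and sig: "\<exists>k. has_signature (g c x) k k"
    using hn c x by (auto simp: hermitian_norden_metric_def neutral_metric_def is_bilinear_field_def)
  note alg = quaternion_relations[OF _ c x]
  have gJ: "g c x (J \<alpha> c x u) (J \<alpha> c x v) = hn_sign \<alpha> * g c x u v" if "\<alpha> \<in> {1, 2, 3}" for \<alpha> u v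
    using hn c x that unfolding hermitian_norden_metric_def by blast
  show ?thesis
  proof (intro hermitian_norden_space.intro pseudo_euclidean_form.intro hermitian_norden_space_axioms.intro)
    show "J 2 c x (J 1 c x u) = - J 1 c x (J 2 c x u)" for u
      using alg(1,2)[OF cyclic_triples_mem(3), of u] by (metis minus_minus)
    show "g c x (J 1 c x u) (J 1 c x v) = g c x u v" for u v
      using gJ[of 1 u v] by (simp add: hn_sign_def)
    show "g c x (J 2 c x u) (J 2 c x v) = - g c x u v" for u v
      using gJ[of 2 u v] by (simp add: hn_sign_def)
  qed (use lin bil sym sig alg(3)[OF cyclic_triples_mem(1)] alg(3)[OF cyclic_triples_mem(2)] in blast)+
qed

lemma J3_eq: "c \<in> A \<Longrightarrow> x \<in> coord_dom c \<Longrightarrow> J 3 c x u = J 1 c x (J 2 c x u)"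
  by (rule quaternion_relations(1)[OF cyclic_triples_mem(3)])

lemma qk_chart_at:
  assumes c: "c \<in> A" and W: "openin X W" and \<omega>: "qk_forms W \<omega>"
  shows "qk_chart (snd c ` (fst c \<inter> W)) (D c) (g c) (J 1 c) (J 2 c) (\<omega> 1 c) n"
proof -
  define S where "S = snd c ` (fst c \<inter> W)"
  have ch: "is_chart X c" using mfd c by (auto simp: smooth_manifold_def)
  have S: "open S" unfolding S_def by (rule open_chart_image[OF ch W])
  have sub: "S \<subseteq> coord_dom c" by (auto simp: S_def coord_dom_def)
  note restrict = smooth_on_subset[OF _ sub]
  have \<Gamma>_bil: "bilinear (D c x)" if "x \<in> S" for x
    using lc c that sub by (auto simp: levi_civita_def affine_connection_def)
  have \<Gamma>0: "D c x u 0 = 0" if "x \<in> S" for x u by (rule bilinear_rzero[OF \<Gamma>_bil[OF that]])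
  have tor_all: "nabla (D c) Y Z x - nabla (D c) Z Y x = lie_bracket Y Z x"
    if "smooth_on (coord_dom c) Y" "smooth_on (coord_dom c) Z" "x \<in> coord_dom c" for Y Z x
    using lc c that unfolding levi_civita_def by blast
  have metric_all: "frechet_derivative (\<lambda>z. g c z (Z z) (V z)) (at x) (Y x) =
      g c x (nabla (D c) Y Z x) (V x) + g c x (Z x) (nabla (D c) Y V x)"
    if "smooth_on (coord_dom c) Y" "smooth_on (coord_dom c) Z" "smooth_on (coord_dom c) V"
      "x \<in> coord_dom c" for Y Z V x
    using lc c that unfolding levi_civita_def by blast
  have tor: "nabla (D c) (\<lambda>_. u) (\<lambda>_. v) x - nabla (D c) (\<lambda>_. v) (\<lambda>_. u) x
      = lie_bracket (\<lambda>_. u) (\<lambda>_. v) x" if "x \<in> S" for x u v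
    by (rule tor_all) (use that sub in auto)
  have conn: "chart_connection S (D c)"
  proof
    show "open S" by (rule S)
    show "bilinear (D c z)" if "z \<in> S" for z by (rule \<Gamma>_bil[OF that])
    show "smooth_on S (\<lambda>z. D c z u v)" for u v
      by (rule restrict) (use lc c in \<open>auto simp: levi_civita_def affine_connection_def\<close>)
    show "D c z u v = D c z v u" if "z \<in> S" for z u v
      using tor[OF that, of u v] by (simp add: nabla_def lie_bracket_def)
  qed
  have g_smooth: "smooth_on S (\<lambda>z. g c z v w)" for v w
    by (rule restrict) (use hn c in \<open>auto simp: hermitian_norden_metric_def neutral_metric_def is_bilinear_field_def\<close>)
  have J_smooth: "smooth_on S (\<lambda>z. J \<alpha> c z w)" if "\<alpha> \<in> {1,2,3}" for \<alpha> w
    by (rule restrict) (use ahc c that in \<open>auto simp: almost_hypercomplex_def is_endo_field_def\<close>)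
  have \<omega>_form: "one_form_on A W (\<omega> \<alpha>)" if "\<alpha> \<in> {1,2,3}" for \<alpha>
    using \<omega> that unfolding qk_forms_def by blast
  have g_parallel: "frechet_derivative (\<lambda>z. g c z v w) (at x) u = g c x (D c x u v) w + g c x v (D c x u w)"
    if "x \<in> S" for x u v w
  proof -
    have "frechet_derivative (\<lambda>z. g c z v w) (at x) u =
        g c x (nabla (D c) (\<lambda>_. u) (\<lambda>_. v) x) w + g c x v (nabla (D c) (\<lambda>_. u) (\<lambda>_. w) x)"
      using metric_all[of "\<lambda>_. u" "\<lambda>_. v" "\<lambda>_. w" x] that sub by auto
    then show ?thesis by (simp add: nabla_def)
  qed
  have dJ: "frechet_derivative (\<lambda>z. J \<alpha> c z w) (at x) u = J \<alpha> c x (D c x u w) - D c x u (J \<alpha> c x w)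
      + (\<omega> \<gamma> c x u *\<^sub>R J \<beta> c x w - \<omega> \<beta> c x u *\<^sub>R J \<gamma> c x w)"
    if "(\<alpha>, \<beta>, \<gamma>) \<in> cyclic_triples" "x \<in> S" for \<alpha> \<beta> \<gamma> x u w
  proof -
    have "nabla_endo (D c) (J \<alpha> c) (\<lambda>_. u) (\<lambda>_. w) x =
        \<omega> \<gamma> c x u *\<^sub>R J \<beta> c x w - \<omega> \<beta> c x u *\<^sub>R J \<gamma> c x w"
      using \<omega> that c unfolding qk_forms_def S_def by fastforce
    then show ?thesis by (simp add: nabla_endo_def nabla_def algebra_simps)
  qed
  \<comment> \<open>\<open>J1\<close> is skew, hence so is its covariant derivative; but that is a combination of the symmetric
    endomorphisms \<open>J2\<close> and \<open>J3\<close>, so it vanishes together with its coefficients\<close>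
  have \<omega>_zero: "\<omega> 3 c x u = 0 \<and> \<omega> 2 c x u = 0" if x: "x \<in> S" for x u
  proof -
    interpret hermitian_norden_space "g c x" "J 1 c x" "J 2 c x"
      by (rule hermitian_norden_space_at) (use c x sub in auto)
    have xc: "x \<in> coord_dom c" using x sub by blast
    define N where "N w = \<omega> 3 c x u *\<^sub>R J 2 c x w - \<omega> 2 c x u *\<^sub>R J 1 c x (J 2 c x w)" for w
    have N_skew: "g c x (N w) z = - g c x w (N z)" for w z
    proof (rule chart_connection.covariant_derivative_of_skew_is_skew
        [where g = "g c" and E = "J 1 c" and N = N and u = u, OF conn x])
      show "smooth_on S (\<lambda>z. g c z v w)" for v w by (rule g_smooth)
      show "frechet_derivative (\<lambda>z. g c z v w) (at x) u = g c x (D c x u v) w + g c x v (D c x u w)" for u v w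
        by (rule g_parallel[OF x])
      show "bilinear (g c y)" if "y \<in> S" for y
        using hermitian_norden_space_at[OF c, of y] that sub
        by (auto simp: hermitian_norden_space_def pseudo_euclidean_form_def)
      show "smooth_on S (\<lambda>z. J 1 c z w)" for w by (rule J_smooth) simp
      show "g c y (J 1 c y a) b = - g c y a (J 1 c y b)" if "y \<in> S" for y a b
        by (rule hermitian_norden_space.g_J1_skew[OF hermitian_norden_space_at[OF c]])
          (use that sub in auto)
      show "frechet_derivative (\<lambda>z. J 1 c z w) (at x) u = J 1 c x (D c x u w) - D c x u (J 1 c x w) + N w" for w
        using dJ[OF cyclic_triples_mem(1) x] J3_eq[OF c xc] by (simp add: N_def)
    qed
    have "\<omega> 3 c x u * g c x (J 2 c x w) z - \<omega> 2 c x u * g c x (J 1 c x (J 2 c x w)) z = 0" for w z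
    proof -
      have "g c x w (J 1 c x (J 2 c x z)) = g c x (J 1 c x (J 2 c x w)) z"
        using g_J1_skew[of w "J 2 c x z"] g_J2_sym[of "J 1 c x w" z] J2_J1[of w]
        by (simp add: g_simps)
      then have "g c x w (N z) = g c x (N w) z"
        by (simp add: N_def g_simps g_J2_sym)
      then show ?thesis using N_skew[of w z] by (simp add: N_def g_simps)
    qed
    then show ?thesis by (rule norden_combination_eq_0)
  qed
  have "qk_chart S (D c) (g c) (J 1 c) (J 2 c) (\<omega> 1 c) n"
  proof (intro qk_chart.intro qk_chart_axioms.intro conn)
    show "CARD('m) = 4 * n" "2 \<le> n" using dim dim_ge by auto
    show "hermitian_norden_space (g c z) (J 1 c z) (J 2 c z)" if "z \<in> S" for z
      using that sub by (intro hermitian_norden_space_at c) auto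
    show "smooth_on S (\<lambda>z. g c z v w)" for v w by (rule g_smooth)
    show "smooth_on S (\<lambda>z. J 1 c z w)" "smooth_on S (\<lambda>z. J 2 c z w)" for w by (rule J_smooth, simp)+
    show "smooth_on S (\<lambda>z. \<omega> 1 c z w)" for w
      using \<omega>_form[of 1] c by (simp add: one_form_on_def S_def)
    show "linear (\<omega> 1 c z)" if "z \<in> S" for z
      using \<omega>_form[of 1] c that unfolding one_form_on_def S_def by auto
    show "frechet_derivative (\<lambda>z. g c z v w) (at z) u = g c z (D c z u v) w + g c z v (D c z u w)"
      if "z \<in> S" for z u v w by (rule g_parallel[OF that])
    show "frechet_derivative (\<lambda>z. J 1 c z w) (at z) u = J 1 c z (D c z u w) - D c z u (J 1 c z w)"
      if "z \<in> S" for z u w using dJ[OF cyclic_triples_mem(1) that] \<omega>_zero[OF that] by simp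
    show "frechet_derivative (\<lambda>z. J 2 c z w) (at z) u = J 2 c z (D c z u w) - D c z u (J 2 c z w)
       + \<omega> 1 c z u *\<^sub>R J 1 c z (J 2 c z w)"
      if "z \<in> S" for z u w
      using dJ[OF cyclic_triples_mem(2) that] \<omega>_zero[OF that] J3_eq[OF c] that sub by auto
  qed
  then show ?thesis by (simp add: S_def)
qed

text \<open>In every chart \<open>d\<omega>\<^sub>1\<close> is a multiple of the fundamental form, and both forms are tensorial. So
  the factor depends on the point alone, and with it the Einstein factor.\<close>

lemma qk_factor_on:
  assumes W: "openin X W" and \<omega>: "qk_forms W \<omega>"
  shows "\<exists>l. \<forall>c\<in>A. \<forall>p \<in> fst c \<inter> W. 
    (\<forall>u v. ext_deriv (\<omega> 1 c) (snd c p) u v = l p * g c (snd c p) (J 1 c (snd c p) u) v) \<and>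
    (\<forall>v w. ricci (D c) (snd c p) v w = - (real n * l p) * g c (snd c p) v w)"
proof -
  have "\<exists>l. \<forall>c\<in>A. p \<in> fst c \<longrightarrow>
    (\<forall>u v. ext_deriv (\<omega> 1 c) (snd c p) u v = l * g c (snd c p) (J 1 c (snd c p) u) v) \<and>
    (\<forall>v w. ricci (D c) (snd c p) v w = - (real n * l) * g c (snd c p) v w)" if p: "p \<in> W" for p
  proof -
    define \<Omega> where "\<Omega> c = ext_deriv (\<omega> 1 c) (snd c p)" for c
    define F where "F c u = g c (snd c p) (J 1 c (snd c p) u)" for c u
    define ok where "ok c l \<longleftrightarrow> (\<forall>u v. \<Omega> c u v = l * F c u v) \<and>
      (\<forall>v w. ricci (D c) (snd c p) v w = - (real n * l) * g c (snd c p) v w)" for c l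
    have ex: "\<exists>l. ok c l" if c: "c \<in> A" "p \<in> fst c" for c
      using qk_chart.einstein_factor[OF qk_chart_at[OF c(1) W \<omega>], of "snd c p"] c p
      unfolding ok_def \<Omega>_def F_def by blast
    have "l = l'" if c: "c \<in> A" "p \<in> fst c" "c' \<in> A" "p \<in> fst c'" and l: "ok c l" "ok c' l'" for c c' l l'
    proof -
      interpret hermitian_norden_space "g c (snd c p)" "J 1 c (snd c p)" "J 2 c (snd c p)"
        by (rule hermitian_norden_space_at) (use c in \<open>auto simp: coord_dom_def\<close>)
      obtain u v where uv: "F c u v \<noteq> 0" using fundamental_form_nonzero unfolding F_def by blast
      have "one_form_on A W (\<omega> 1)" using \<omega> by (simp add: qk_forms_def)
      from ext_deriv_natural[OF mfd W this c(1,3,2,4) p]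
      have "\<Omega> c' (jac c c' (snd c p) u) (jac c c' (snd c p) v) = \<Omega> c u v"
        by (simp add: \<Omega>_def)
      moreover have "F c' (jac c c' (snd c p) u) (jac c c' (snd c p) v) = F c u v"
      proof -
        have "J 1 c' (snd c' p) (jac c c' (snd c p) u) = jac c c' (snd c p) (J 1 c (snd c p) u)"
          using ahc c by (auto simp: almost_hypercomplex_def is_endo_field_def)
        moreover have "g c' (snd c' p) (jac c c' (snd c p) a) (jac c c' (snd c p) v) = g c (snd c p) a v" for a
          using hn c by (auto simp: hermitian_norden_metric_def neutral_metric_def is_bilinear_field_def)
        ultimately show ?thesis by (simp add: F_def)
      qed
      ultimately have "l' * F c u v = l * F c u v" using l unfolding ok_def by metis
      then show ?thesis using uv by simp
    qed
    then have "\<exists>l. \<forall>c\<in>A. p \<in> fst c \<longrightarrow> ok c l" using ex by metis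
    then show ?thesis unfolding ok_def \<Omega>_def F_def .
  qed
  then show ?thesis by (metis IntE)
qed

text \<open>Read in a chart around \<open>p\<close>, the factor has zero derivative, so it is constant on a coordinate ball.\<close>

lemma ricci_factor_locally_constant:
  assumes p: "p \<in> topspace X"
  obtains V r where "openin X V" "p \<in> V"
    "\<And>c q u v. c \<in> A \<Longrightarrow> q \<in> fst c \<inter> V \<Longrightarrow> ricci (D c) (snd c q) u v = r * g c (snd c q) u v"
proof -
  obtain W \<omega> where W: "openin X W" "p \<in> W" and \<omega>: "qk_forms W \<omega>" by (rule obtain_qk_forms[OF p])
  obtain l where l: "\<And>c q u v. c \<in> A \<Longrightarrow> q \<in> fst c \<inter> W \<Longrightarrow>
      ext_deriv (\<omega> 1 c) (snd c q) u v = l q * g c (snd c q) (J 1 c (snd c q) u) v"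
    "\<And>c q u v. c \<in> A \<Longrightarrow> q \<in> fst c \<inter> W \<Longrightarrow>
      ricci (D c) (snd c q) u v = - (real n * l q) * g c (snd c q) u v"
    using qk_factor_on[OF W(1) \<omega>] by blast
  obtain c where c: "c \<in> A" "p \<in> fst c" by (rule obtain_chart[OF p])
  have ch: "is_chart X c" using mfd c by (auto simp: smooth_manifold_def)
  define S where "S = snd c ` (fst c \<inter> W)"
  interpret qk_chart S "D c" "g c" "J 1 c" "J 2 c" "\<omega> 1 c" n
    unfolding S_def by (rule qk_chart_at[OF c(1) W(1) \<omega>])
  have "snd c p \<in> S" using c W by (auto simp: S_def)
  then obtain e where e: "e > 0" "ball (snd c p) e \<subseteq> S" using S open_contains_ball by blast
  define m where "m z = l (param c z)" for z
  have m: "m (snd c q) = l q" if "q \<in> fst c" for q using param_chart[OF ch that] by (simp add: m_def)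
  have dm: "(m has_derivative (\<lambda>_. 0)) (at z)" if "z \<in> S" for z
  proof (rule factor_derivative_zero[OF _ that])
    fix z u v assume "z \<in> S"
    then obtain q where "q \<in> fst c \<inter> W" "z = snd c q" by (auto simp: S_def)
    then show "ext_deriv (\<omega> 1 c) z u v = m z * g c z (J 1 c z u) v"
      using l(1)[OF c(1)] m by auto
  qed
  have const: "m z = m (snd c p)" if "z \<in> ball (snd c p) e" for z
  proof (rule has_derivative_zero_unique[OF convex_ball _ that])
    fix y assume "y \<in> ball (snd c p) e"
    then have "y \<in> S" using e(2) by blast
    then show "(m has_derivative (\<lambda>_. 0)) (at y within ball (snd c p) e)"
      by (rule has_derivative_at_withinI[OF dm])
  next
    show "snd c p \<in> ball (snd c p) e" using e(1) by simp
  qed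
  define V where "V = {q \<in> fst c. snd c q \<in> ball (snd c p) e}"
  have V: "openin X V" unfolding V_def by (rule openin_chart_preimage[OF ch]) simp
  have VW: "q \<in> W" if "q \<in> V" for q
  proof -
    have "snd c q \<in> S" using that e by (auto simp: V_def)
    then obtain q' where "q' \<in> fst c \<inter> W" "snd c q = snd c q'" by (auto simp: S_def)
    then show ?thesis using chart_inj[OF ch] that by (auto simp: V_def inj_on_def)
  qed
  show ?thesis
  proof (rule that[OF V, of "- (real n * l p)"])
    show "p \<in> V" using c e by (simp add: V_def)
    fix c' q u v assume q: "c' \<in> A" "q \<in> fst c' \<inter> V"
    have "l q = l p" using const[of "snd c q"] m[of q] m[of p] q c by (simp add: V_def)
    then show "ricci (D c') (snd c' q) u v = - (real n * l p) * g c' (snd c' q) u v"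
      using l(2)[of c' q u v] q VW by simp
  qed
qed

text \<open>The local factors fit together because \<open>g\<close> is nowhere zero and so determines them.\<close>

lemma einstein: "einstein X A g D"
proof -
  have "\<exists>r V. openin X V \<and> p \<in> V \<and> (\<forall>c\<in>A. \<forall>q \<in> fst c \<inter> V. \<forall>u v.
      ricci (D c) (snd c q) u v = r * g c (snd c q) u v)" if "p \<in> topspace X" for p
    using ricci_factor_locally_constant[OF that] by metis
  then obtain k where k: "\<And>p. p \<in> topspace X \<Longrightarrow> \<exists>V. openin X V \<and> p \<in> V \<and> (\<forall>c\<in>A. \<forall>q \<in> fst c \<inter> V. \<forall>u v.
      ricci (D c) (snd c q) u v = k p * g c (snd c q) u v)"
    by metis
  have chart_sub: "fst c \<subseteq> topspace X" if "c \<in> A" for c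
    using mfd that unfolding smooth_manifold_def by blast
  have ric: "ricci (D c) (snd c p) u v = k p * g c (snd c p) u v" if "c \<in> A" "p \<in> fst c" for c p u v
    using k[of p] chart_sub that by blast
  have "\<exists>U. openin X U \<and> p \<in> U \<and> (\<forall>q\<in>U. k q = k p)" if p: "p \<in> topspace X" for p
  proof -
    obtain V where V: "openin X V" "p \<in> V" "\<And>c q u v. c \<in> A \<Longrightarrow> q \<in> fst c \<inter> V \<Longrightarrow>
      ricci (D c) (snd c q) u v = k p * g c (snd c q) u v" using k[OF p] by blast
    have "k q = k p" if q: "q \<in> V" for q
    proof -
      have "q \<in> topspace X" using V(1) q openin_subset by blast
      then obtain c where c: "c \<in> A" "q \<in> fst c" by (rule obtain_chart)
      interpret hermitian_norden_space "g c (snd c q)" "J 1 c (snd c q)" "J 2 c (snd c q)"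
        by (rule hermitian_norden_space_at) (use c in \<open>auto simp: coord_dom_def\<close>)
      obtain u where "g c (snd c q) u u \<noteq> 0" using exists_non_null by blast
      moreover have "k q * g c (snd c q) u u = k p * g c (snd c q) u u"
        by (rule trans[OF ric[OF c, symmetric] V(3)[OF c(1)]]) (use c(2) q in auto)
      ultimately show ?thesis by simp
    qed
    then show ?thesis using V by blast
  qed
  then show ?thesis
    unfolding einstein_def
    using ric locally_constant_imp_constant_on_connected[of X k] by blast
qed

end

theorem theorem13p7:
  fixes X :: "'a topology"
    and A :: "('a, 'm::finite) chart set"
    and J :: "nat \<Rightarrow> ('a, 'm) endo_field"
    and g :: "('a, 'm) bilinear_field"
    and D :: "('a, 'm) connection"
    and n :: nat
  assumes "smooth_manifold X A"
    and "CARD('m) = 4 * n" and "4 * n \<ge> 8"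
    and "almost_hypercomplex A J"
    and "hermitian_norden_metric A J g"
    and "levi_civita A g D"
    and "quaternionic_kaehler X A J D"
  shows "einstein X A g D"
proof -
  interpret qk_manifold X A J g D n
    using assms by (rule qk_manifold.intro)
  show ?thesis by (rule einstein)
qed

end
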